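(* Fix $r\in(0,\infty)$. Let $(s_n)_{n\ge1}$ be a sequence of positive integers with $s_n\le n$, and put $\eta_n=s_n/n$. If $\eta_n\to0$ as $n\to\infty$, then $$R_N(\Theta_n[s_n])\sim\frac{1}{1+r}\,s_n\log(n/s_n)=\frac{1}{1+r}\,n\,\eta_n\log\eta_n^{-1},$$ where $a_n\sim b_n$ means $a_n/b_n\to1$ as $n\to\infty$.
   Context: Model: for $\theta\in\mathbb{R}^n$, the past observation $X\sim N_n(\theta,I)$ and the future observation $Y\sim N_n(\theta,rI)$ are independent given $\theta$; $r>0$ is known and fixed. Write $p(x|\theta,1)$ and $p(y|\theta,r)$ for their densities. A predictive density estimator is a measurable $\hat p(y|x)$ such that $\hat p(\cdot|x)$ is a probability density on $\mathbb{R}^n$ for each $x\in\mathbb{R}^n$. Its Kullback--Leibler loss is $L(\theta,\hat p(\cdot|x))=\int p(y|\theta,r)\log\frac{p(y|\theta,r)}{\hat p(y|x)}\,dy$ and its risk is $\rho(\theta,\hat p)=\int L(\theta,\hat p(\cdot|x))\,p(x|\theta,1)\,dx$. Parameter space: $\Theta_n[s]=\{\theta\in\mathbb{R}^n:\#\{i:\theta_i\ne0\}\le s\}$. Minimax risk: $R_N(\Theta)=\inf_{\hat p}\sup_{\theta\in\Theta}\rho(\theta,\hat p)$, the infimum being over all predictive density estimators. *)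

theory Defs
  imports "HOL-Probability.Probability"
begin

text \<open>
  The dimension \<open>n\<close> varies within the statement, so \<open>\<real>\<^sup>n\<close> is the space of extensional functions on
  \<open>{..<n}\<close> with the product of Lebesgue measures on the Borel sets.
\<close>

definition euclid :: "nat \<Rightarrow> (nat \<Rightarrow> real) measure" where
  "euclid n = Pi\<^sub>M {..<n} (\<lambda>_. lborel)"

text \<open>Density of \<open>N\<^sub>n(\<theta>, v I)\<close>; \<^const>\<open>normal_density\<close> takes the standard deviation.\<close>

definition gauss_density :: "nat \<Rightarrow> (nat \<Rightarrow> real) \<Rightarrow> real \<Rightarrow> (nat \<Rightarrow> real) \<Rightarrow> real" where
  "gauss_density n \<theta> v x = (\<Prod>i<n. normal_density (\<theta> i) (sqrt v) (x i))"

text \<open>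
  The Kullback--Leibler loss and the risk may be infinite, whereas the Bochner integral of a
  non-integrable function is \<open>0\<close>. Hence integrals of extended real functions are taken as the
  integral of the positive part minus that of the negative part (\<^const>\<open>e2ennreal\<close> sends
  negative numbers to \<open>0\<close>). Below, the negative part always has a finite integral.
\<close>

definition ext_integral :: "'a measure \<Rightarrow> ('a \<Rightarrow> ereal) \<Rightarrow> ereal" where
  "ext_integral M f =
     enn2ereal (\<integral>\<^sup>+ x. e2ennreal (f x) \<partial>M) - enn2ereal (\<integral>\<^sup>+ x. e2ennreal (- f x) \<partial>M)"

text \<open>\<open>log (p / q)\<close> for \<open>p > 0\<close> and \<open>q \<ge> 0\<close>, with the value \<open>\<infinity>\<close> at \<open>q = 0\<close>.\<close>

definition log_ratio :: "real \<Rightarrow> real \<Rightarrow> ereal" where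
  "log_ratio p q = (if q = 0 then \<infinity> else ereal (ln (p / q)))"

text \<open>An estimator \<open>p\<close> is applied as \<open>p x y\<close> for the value written \<open>p(y | x)\<close> in statistics.\<close>

definition predictive_density_estimators ::
    "nat \<Rightarrow> ((nat \<Rightarrow> real) \<Rightarrow> (nat \<Rightarrow> real) \<Rightarrow> real) set" where
  "predictive_density_estimators n =
     {p. (\<lambda>(x, y). p x y) \<in> borel_measurable (euclid n \<Otimes>\<^sub>M euclid n) \<and>
         (\<forall>x\<in>space (euclid n).
            (\<forall>y\<in>space (euclid n). 0 \<le> p x y) \<and>
            (\<integral>\<^sup>+ y. ennreal (p x y) \<partial>euclid n) = 1)}"

definition KL_loss :: "nat \<Rightarrow> real \<Rightarrow> (nat \<Rightarrow> real) \<Rightarrow> ((nat \<Rightarrow> real) \<Rightarrow> real) \<Rightarrow> ereal" where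
  "KL_loss n r \<theta> q =
     ext_integral (euclid n)
       (\<lambda>y. ereal (gauss_density n \<theta> r y) * log_ratio (gauss_density n \<theta> r y) (q y))"

definition KL_risk ::
    "nat \<Rightarrow> real \<Rightarrow> (nat \<Rightarrow> real) \<Rightarrow> ((nat \<Rightarrow> real) \<Rightarrow> (nat \<Rightarrow> real) \<Rightarrow> real) \<Rightarrow> ereal" where
  "KL_risk n r \<theta> p =
     ext_integral (euclid n) (\<lambda>x. KL_loss n r \<theta> (p x) * ereal (gauss_density n \<theta> 1 x))"

definition sparse_params :: "nat \<Rightarrow> nat \<Rightarrow> (nat \<Rightarrow> real) set" where
  "sparse_params n s = {\<theta> \<in> space (euclid n). card {i \<in> {..<n}. \<theta> i \<noteq> 0} \<le> s}"

definition minimax_risk :: "nat \<Rightarrow> real \<Rightarrow> (nat \<Rightarrow> real) set \<Rightarrow> ereal" where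
  "minimax_risk n r \<Theta> =
     (INF p \<in> predictive_density_estimators n. SUP \<theta> \<in> \<Theta>. KL_risk n r \<theta> p)"

end

theory Submission
  imports Defs "HOL-Real_Asymp.Real_Asymp"
begin

text \<open>
  Put \<open>L = ln (n / s)\<close>. Up to an error of order \<open>sqrt L\<close>, each of the \<open>s\<close> nonzero coordinates costs
  \<open>L / (1 + r)\<close>, and the remaining coordinates together cost only \<open>O(s sqrt L)\<close>.

  \<^emph>\<open>Lower bound.\<close> Cut \<open>s m\<close> of the coordinates, \<open>m = n div s\<close>, into \<open>s\<close> blocks of length \<open>m\<close> and put one
  spike of height \<open>\<mu>\<close> at a uniformly chosen place of each block. If \<open>M\<close> is the resulting mixture of the
  joint laws of \<open>(X, Y)\<close> and \<open>p\<close> any estimator, then \<open>p(y|x)\<close> times the null density of \<open>x\<close> is a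
  probability density, so by Gibbs' inequality \<open>p\<close> cannot beat \<open>M\<close> on average
  (\<open>minimax_risk_ge_mixture\<close>). Hence the average risk is at least the divergence \<open>s \<mu>\<^sup>2 / (2 r)\<close> of the
  law of \<open>Y\<close> from the null, minus the divergence of \<open>M\<close> from the joint null. The pair \<open>(X, Y)\<close> is
  as informative as one observation of variance \<open>v = r / (1 + r)\<close>; at the critical height
  \<open>\<mu>\<^sup>2 = 2 v ln m\<close> a spike is still hidden among the \<open>m\<close> noise coordinates of its block, so the second
  divergence is \<open>O(\<mu>)\<close> per block, while \<open>\<mu>\<^sup>2 / (2 r) = ln m / (1 + r)\<close>
  (\<open>minimax_risk_lower\<close>).

  \<^emph>\<open>Upper bound.\<close> In each coordinate use the Bayes predictive density for a unit mass at \<open>0\<close> plus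
  \<open>\<eta> / sqrt (2 \<pi>)\<close> times Lebesgue measure, \<open>\<eta> = s / n = exp (- L)\<close>. It is a convex combination of
  \<open>N(0, r)\<close> and \<open>N(x, 1 + r)\<close> with a weight that switches at \<open>x\<^sup>2 / 2 = L\<close>. Keeping only one of the
  two components bounds the logarithmic loss by the loss of that component plus minus the logarithm of its
  weight. For a mean \<open>a\<close> with \<open>a\<^sup>2 / 2 \<le> v L\<close> the first component gives about
  \<open>a\<^sup>2 / (2 r) \<le> L / (1 + r)\<close>; otherwise the second gives about the positive part of
  \<open>L - a\<^sup>2 / 2\<close>, at most \<open>L / (1 + r)\<close>.
  The two bounds meet at the critical height. At \<open>a = 0\<close> the risk is \<open>O(\<eta> sqrt L)\<close>
  (\<open>minimax_risk_upper\<close>).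
\<close>

section \<open>Extended integrals and Gaussian means\<close>

abbreviation has_normal_mean :: "real \<Rightarrow> real \<Rightarrow> (real \<Rightarrow> real) \<Rightarrow> real \<Rightarrow> bool" where
  "has_normal_mean a v f c \<equiv>
     has_bochner_integral lborel (\<lambda>t. normal_density a (sqrt v) t * f t) c"

abbreviation has_gauss_mean ::
    "nat \<Rightarrow> (nat \<Rightarrow> real) \<Rightarrow> real \<Rightarrow> ((nat \<Rightarrow> real) \<Rightarrow> real) \<Rightarrow> real \<Rightarrow> bool" where
  "has_gauss_mean n \<theta> v f c \<equiv>
     has_bochner_integral (euclid n) (\<lambda>x. gauss_density n \<theta> v x * f x) c"

text \<open>
  The integral of nonnegative functions is a supremum over simple minorants, hence monotone for arbitrary functions. Risks
  are therefore bounded below by pointwise minorants and above by pointwise majorants that are Bochner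
  integrable, and the loss of an arbitrary estimator never has to be shown integrable.
\<close>

lemma ext_integral_mono:
  assumes "\<And>x. x \<in> space M \<Longrightarrow> f x \<le> g x"
  shows "ext_integral M f \<le> ext_integral M g"
  unfolding ext_integral_def
  by (intro ereal_minus_mono)
     (auto simp: less_eq_ennreal.rep_eq[symmetric] intro!: nn_integral_mono e2ennreal_mono assms)

lemma ext_integral_ereal:
  assumes "has_bochner_integral M h c"
  shows "ext_integral M (\<lambda>x. ereal (h x)) = ereal c"
proof -
  have int: "integrable M h" and c: "integral\<^sup>L M h = c"
    using assms by (auto simp: has_bochner_integral_iff)
  have pos: "integrable M (\<lambda>x. max 0 (h x))" and neg: "integrable M (\<lambda>x. max 0 (- h x))"
    using int by auto
  have e: "e2ennreal (ereal z) = ennreal (max 0 z)" for z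
    by (cases "0 \<le> z") (auto simp: max_absorb1 max_absorb2 ennreal_neg)
  have "(\<integral>\<^sup>+ x. e2ennreal (ereal (h x)) \<partial>M) = ennreal (\<integral>x. max 0 (h x) \<partial>M)"
    unfolding e by (rule nn_integral_eq_integral[OF pos]) auto
  moreover have "(\<integral>\<^sup>+ x. e2ennreal (- ereal (h x)) \<partial>M) = ennreal (\<integral>x. max 0 (- h x) \<partial>M)"
    unfolding uminus_ereal.simps e by (rule nn_integral_eq_integral[OF neg]) auto
  moreover have "(\<integral>x. max 0 (h x) \<partial>M) - (\<integral>x. max 0 (- h x) \<partial>M) = c"
    unfolding Bochner_Integration.integral_diff[OF pos neg, symmetric] c[symmetric]
    by (rule Bochner_Integration.integral_cong) auto
  ultimately show ?thesis
    by (simp add: ext_integral_def)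
qed

lemma ext_integral_le:
  assumes "has_bochner_integral M h c" "\<And>x. x \<in> space M \<Longrightarrow> f x \<le> ereal (h x)"
  shows "ext_integral M f \<le> ereal c"
  using ext_integral_mono[of M f "\<lambda>x. ereal (h x)"] ext_integral_ereal[OF assms(1)] assms(2) by simp

lemma ext_integral_ge:
  assumes "has_bochner_integral M h c" "\<And>x. x \<in> space M \<Longrightarrow> ereal (h x) \<le> f x"
  shows "ereal c \<le> ext_integral M f"
  using ext_integral_mono[of M "\<lambda>x. ereal (h x)" f] ext_integral_ereal[OF assms(1)] assms(2) by simp

lemma has_normal_mean_cong:
  "has_normal_mean a v f c \<Longrightarrow> (\<And>t. f t = g t) \<Longrightarrow> c = d \<Longrightarrow> has_normal_mean a v g d"
  by (metis ext)

text \<open>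
  All remainder terms of both bounds are majorised by quadratics in the noise, so their means follow from
  the first two moments.
\<close>

lemma has_normal_mean_quadratic:
  assumes "0 < v"
  shows "has_normal_mean a v (\<lambda>t. c0 + c1 * (t - a) + c2 * (t - a)\<^sup>2) (c0 + c2 * v)"
proof -
  have \<sigma>: "0 < sqrt v" using assms by simp
  note normal_moment_even[OF \<sigma>, of a 0] normal_moment_odd[OF \<sigma>, of a 0] normal_moment_even[OF \<sigma>, of a 1]
  note m = has_bochner_integral_add[OF has_bochner_integral_add[OF
      has_bochner_integral_mult_left[OF this(1), of c0]
      has_bochner_integral_mult_left[OF this(2), of c1]]
      has_bochner_integral_mult_left[OF this(3), of c2]]
  show ?thesis
    by (rule iffD1[OF has_bochner_integral_cong m])
       (use assms in \<open>auto simp: algebra_simps fact_numeral power2_eq_square\<close>)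
qed

lemma has_normal_mean_one: "0 < v \<Longrightarrow> has_normal_mean a v (\<lambda>t. 1) 1"
  using has_normal_mean_quadratic[of v a 1 0 0] by simp

lemma normal_density_shift:
  assumes "0 < v"
  shows "normal_density a (sqrt v) t = normal_density 0 (sqrt v) t * exp ((a * t - a\<^sup>2 / 2) / v)"
proof -
  have "- (t - a)\<^sup>2 / (2 * v) = - t\<^sup>2 / (2 * v) + (a * t - a\<^sup>2 / 2) / v"
    using assms by (simp add: field_simps power2_eq_square)
  then show ?thesis
    using assms by (simp add: normal_density_def exp_add[symmetric])
qed

lemma has_normal_mean_exp_tilt:
  assumes "0 < v"
  shows "has_normal_mean 0 v (\<lambda>t. exp ((a * t - a\<^sup>2 / 2) / v)) 1"
  using has_normal_mean_one[OF assms, of a] by (simp add: normal_density_shift[OF assms, of a])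

lemma ln_normal_density:
  assumes "0 < v"
  shows "ln (normal_density a (sqrt v) y) = - ln (2 * pi * v) / 2 - (y - a)\<^sup>2 / (2 * v)"
proof -
  have "ln (1 / sqrt X * exp E) = - ln X / 2 + E" if "0 < X" for X E :: real
    using that by (simp add: ln_mult ln_div ln_sqrt)
  from this[of "2 * pi * v" "- (y - a)\<^sup>2 / (2 * v)"] show ?thesis
    using assms by (simp add: normal_density_def)
qed

text \<open>
  The integrand is the density of \<open>N(0, 1 / (1 - a))\<close> up to a constant; the mean explodes as \<open>a\<close>
  approaches \<open>1\<close>, which is what limits the exponent in the bound for the risk at \<open>0\<close>.
\<close>

lemma has_normal_mean_exp_square:
  assumes "0 \<le> a" "a < 1"
  shows "has_normal_mean 0 1 (\<lambda>t. exp (a * t\<^sup>2 / 2)) (1 / sqrt (1 - a))"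
proof -
  let ?v = "1 / (1 - a)"
  have v: "0 < ?v" using assms by simp
  have "normal_density 0 (sqrt ?v) t * sqrt ?v = normal_density 0 (sqrt 1) t * exp (a * t\<^sup>2 / 2)" for t
  proof -
    have "- t\<^sup>2 / (2 * ?v) = - t\<^sup>2 / 2 + a * t\<^sup>2 / 2"
      using assms by (simp add: field_simps)
    moreover have "sqrt ?v * sqrt (1 - a) = 1"
      using assms by (simp add: real_sqrt_divide)
    ultimately show ?thesis
      using assms by (simp add: normal_density_def exp_add[symmetric] real_sqrt_mult real_sqrt_divide power_divide)
  qed
  then show ?thesis
    using has_bochner_integral_mult_left[OF has_normal_mean_one[OF v, of 0], of "sqrt ?v"] assms
    by (simp add: real_sqrt_divide)
qed

text \<open>
  Replaces absolute values of the noise by quadratics.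
\<close>

lemma abs_le_half_one_plus_square: "\<bar>z\<bar> \<le> (1 + z\<^sup>2) / (2::real)"
  using zero_le_power2[of "\<bar>z\<bar> - 1"] by (simp add: power2_diff)

lemma space_euclid: "x \<in> space (euclid n) \<longleftrightarrow> x \<in> extensional {..<n}"
  by (auto simp: euclid_def space_PiM PiE_def)

lemma measurable_coord[measurable]: "i < n \<Longrightarrow> (\<lambda>x. x i) \<in> borel_measurable (euclid n)"
  using measurable_component_singleton[of i "{..<n}" "\<lambda>_. lborel :: real measure"]
  by (simp add: euclid_def)

lemma measurable_gauss_density[measurable]: "gauss_density n \<theta> v \<in> borel_measurable (euclid n)"
  unfolding gauss_density_def by (intro borel_measurable_prod measurable_compose[OF measurable_coord]) auto

lemma gauss_density_pos: "0 < v \<Longrightarrow> 0 < gauss_density n \<theta> v x"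
  unfolding gauss_density_def by (intro prod_pos) (auto simp: normal_density_pos)

interpretation euclid: product_sigma_finite "\<lambda>_. lborel :: real measure" ..

lemma sigma_finite_euclid: "sigma_finite_measure (euclid n)"
  unfolding euclid_def by (rule euclid.sigma_finite) auto

text \<open>
  The integrand factorises over the coordinates, and all factors but the one at \<open>i\<close> integrate to \<open>1\<close>.
\<close>

lemma has_gauss_mean_coord:
  assumes v: "0 < v" and i: "i < n" and h: "has_normal_mean (\<theta> i) v h c"
  shows "has_gauss_mean n \<theta> v (\<lambda>x. h (x i)) c"
proof -
  let ?f = "\<lambda>j t. normal_density (\<theta> j) (sqrt v) t * (if j = i then h t else 1)"
  have f: "has_bochner_integral lborel (?f j) (if j = i then c else 1)" for j
    using h has_normal_mean_one[OF v, of "\<theta> j"] by auto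
  have "has_bochner_integral (euclid n) (\<lambda>x. \<Prod>j<n. ?f j (x j)) (\<Prod>j<n. if j = i then c else 1)"
    using euclid.product_integrable_prod[of "{..<n}" ?f] euclid.product_integral_prod[of "{..<n}" ?f] f
    unfolding has_bochner_integral_iff euclid_def by simp
  moreover have "(\<Prod>j<n. if j = i then c else 1) = c"
    using i by simp
  moreover have "(\<Prod>j<n. ?f j (x j)) = gauss_density n \<theta> v x * h (x i)" for x
    using i by (simp add: prod.distrib gauss_density_def)
  ultimately show ?thesis by simp
qed

lemma has_gauss_mean_one:
  assumes v: "0 < v"
  shows "has_gauss_mean n \<theta> v (\<lambda>x. 1) 1"
proof -
  have "integrable lborel (normal_density a (sqrt v)) \<and> integral\<^sup>L lborel (normal_density a (sqrt v)) = 1" for a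
    using has_normal_mean_one[OF v, of a] by (auto simp: has_bochner_integral_iff)
  then have "has_bochner_integral (euclid n) (\<lambda>x. \<Prod>j<n. normal_density (\<theta> j) (sqrt v) (x j)) 1"
    using euclid.product_integrable_prod[of "{..<n}" "\<lambda>i. normal_density (\<theta> i) (sqrt v)"]
      euclid.product_integral_prod[of "{..<n}" "\<lambda>i. normal_density (\<theta> i) (sqrt v)"]
    unfolding has_bochner_integral_iff euclid_def by simp
  then show ?thesis by (simp add: gauss_density_def)
qed

lemma has_gauss_mean_sum:
  "(\<And>i. i \<in> I \<Longrightarrow> has_gauss_mean n \<theta> v (f i) (c i)) \<Longrightarrow>
   has_gauss_mean n \<theta> v (\<lambda>x. \<Sum>i\<in>I. f i x) (\<Sum>i\<in>I. c i)"
  unfolding sum_distrib_left by (rule has_bochner_integral_sum)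

lemma has_gauss_mean_diff:
  "has_gauss_mean n \<theta> v f c \<Longrightarrow> has_gauss_mean n \<theta> v g d \<Longrightarrow>
   has_gauss_mean n \<theta> v (\<lambda>x. f x - g x) (c - d)"
  unfolding right_diff_distrib by (rule has_bochner_integral_diff)

section \<open>A mixture lower bound for the minimax risk\<close>

text \<open>
  Let \<open>M\<close> be the uniform mixture of the joint densities \<open>f\<^sub>j(x) g\<^sub>j(y)\<close> of \<open>(X, Y)\<close> under \<open>\<theta> j\<close>, and
  \<open>f\<^sub>0\<close> the density of \<open>X\<close> under a reference mean \<open>\<theta>'\<close>. For an estimator \<open>p\<close> put \<open>t = p(y|x) f\<^sub>0(x) / M\<close>.
  Then \<open>ln (g\<^sub>j / p) = ln (g\<^sub>j f\<^sub>0 / M) - ln t \<ge> ln (g\<^sub>j f\<^sub>0 / M) + 1 - t\<close>, and \<open>t\<close> has mean \<open>1\<close>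
  under \<open>M\<close>, so it has mean at most \<open>1\<close> under some \<open>j\<close>. The estimator has disappeared from the bound. The functions
  \<open>b\<close> are explicit minorants of \<open>ln (g\<^sub>j f\<^sub>0 / M)\<close> whose means are computed first over \<open>y\<close>, then over \<open>x\<close>.
\<close>

lemma minimax_risk_ge_mixture:
  fixes \<theta> :: "'j \<Rightarrow> nat \<Rightarrow> real"
  assumes r: "0 < r" and I: "finite I" "I \<noteq> {}" "\<And>j. j \<in> I \<Longrightarrow> \<theta> j \<in> \<Theta>"
    and b: "\<And>j x y. j \<in> I \<Longrightarrow>
      b j x y \<le> ln (gauss_density n (\<theta> j) r y * gauss_density n \<theta>' 1 x /
        ((\<Sum>i\<in>I. gauss_density n (\<theta> i) 1 x * gauss_density n (\<theta> i) r y) / real (card I)))"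
    and B: "\<And>j x. j \<in> I \<Longrightarrow> has_gauss_mean n (\<theta> j) r (b j x) (B j x)"
    and C: "\<And>j. j \<in> I \<Longrightarrow> has_gauss_mean n (\<theta> j) 1 (B j) C"
  shows "ereal C \<le> minimax_risk n r \<Theta>"
  unfolding minimax_risk_def
proof (rule INF_greatest)
  fix p assume "p \<in> predictive_density_estimators n"
  then have pm[measurable]: "(\<lambda>(x, y). p x y) \<in> borel_measurable (euclid n \<Otimes>\<^sub>M euclid n)"
    and p0: "\<And>x y. x \<in> space (euclid n) \<Longrightarrow> y \<in> space (euclid n) \<Longrightarrow> 0 \<le> p x y"
    and p1: "\<And>x. x \<in> space (euclid n) \<Longrightarrow> (\<integral>\<^sup>+ y. ennreal (p x y) \<partial>euclid n) = 1"
    by (auto simp: predictive_density_estimators_def)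
  interpret E: sigma_finite_measure "euclid n" by (rule sigma_finite_euclid)
  define N where "N = real (card I)"
  have N: "0 < N" using I by (simp add: N_def card_gt_0_iff)
  define g where "g = (\<lambda>j. gauss_density n (\<theta> j) r)"
  define f where "f = (\<lambda>j. gauss_density n (\<theta> j) 1)"
  define f0 where "f0 = gauss_density n \<theta>' 1"
  define m where "m = (\<lambda>x y. (\<Sum>j\<in>I. f j x * g j y) / N)"
  have m_eq: "m x y = (\<Sum>j\<in>I. f j x * g j y) / N" for x y
    by (simp add: m_def)
  have [measurable]: "g j \<in> borel_measurable (euclid n)" "f j \<in> borel_measurable (euclid n)"
    "f0 \<in> borel_measurable (euclid n)" for j
    by (auto simp: g_def f_def f0_def)
  have pos: "0 < g j y" "0 < f j y" "0 < f0 y" for j y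
    using r by (auto simp: g_def f_def f0_def gauss_density_pos)
  have m_pos: "0 < m x y" for x y
    unfolding m_eq using I N pos by (intro divide_pos_pos sum_pos) auto
  have m_ge: "f j x * g j y \<le> N * m x y" if "j \<in> I" for j x y
    using N I pos member_le_sum[OF that, of "\<lambda>j. f j x * g j y"] by (simp add: m_eq less_imp_le)
  have p_int: "has_bochner_integral (euclid n) (p x) 1" if x: "x \<in> space (euclid n)" for x
    using p0[OF x] p1[OF x] x by (intro has_bochner_integral_nn_integral) auto
  define t where "t = (\<lambda>x y. p x y * f0 x / m x y)"
  have m_meas[measurable]: "(\<lambda>(x, y). m x y) \<in> borel_measurable (euclid n \<Otimes>\<^sub>M euclid n)"
    unfolding m_eq by measurable
  have t_meas[measurable]: "(\<lambda>(x, y). t x y) \<in> borel_measurable (euclid n \<Otimes>\<^sub>M euclid n)"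
    unfolding t_def by measurable
  have t0: "0 \<le> t x y" if "x \<in> space (euclid n)" "y \<in> space (euclid n)" for x y
    using p0[OF that] m_pos[of x y] pos(3)[of x] by (simp add: t_def)
  \<comment> \<open>Each component is at most \<open>card I\<close> times the mixture; so \<open>f\<^sub>j g\<^sub>j t\<close> is at most a multiple of \<open>f\<^sub>0 p\<close>, which gives integrability.\<close>
  have gt_le: "f j x * (g j y * t x y) \<le> N * f0 x * p x y"
    if j: "j \<in> I" and x: "x \<in> space (euclid n)" and y: "y \<in> space (euclid n)" for j x y
  proof -
    have "f j x * g j y / m x y \<le> N"
      using m_ge[OF j, of x y] m_pos[of x y] by (simp add: divide_le_eq)
    then have "f j x * g j y / m x y * (f0 x * p x y) \<le> N * (f0 x * p x y)"
      using p0[OF x y] pos(3)[of x] by (intro mult_right_mono) auto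
    then show ?thesis by (simp add: t_def mult_ac)
  qed
  have int1: "integrable (euclid n) (\<lambda>y. g j y * t x y)" if j: "j \<in> I" and x: "x \<in> space (euclid n)" for j x
  proof (rule Bochner_Integration.integrable_bound)
    show "integrable (euclid n) (\<lambda>y. N * f0 x / f j x * p x y)"
      using p_int[OF x] by (intro integrable_mult_right) (auto simp: has_bochner_integral_iff)
    show "(\<lambda>y. g j y * t x y) \<in> borel_measurable (euclid n)"
      using x by measurable
    show "AE y in euclid n. norm (g j y * t x y) \<le> norm (N * f0 x / f j x * p x y)"
    proof (rule AE_I2)
      fix y assume y: "y \<in> space (euclid n)"
      have "g j y * t x y \<le> N * f0 x / f j x * p x y"
        using gt_le[OF j x y] pos(2)[of j x] by (simp add: field_simps)
      moreover have "0 \<le> g j y * t x y" using pos(1)[of j y] t0[OF x y] by simp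
      ultimately show "norm (g j y * t x y) \<le> norm (N * f0 x / f j x * p x y)"
        unfolding real_norm_def by linarith
    qed
  qed
  \<comment> \<open>\<open>D j x\<close> and \<open>d j\<close> are the conditional and the total mean of \<open>t\<close> under \<open>\<theta> j\<close>.\<close>
  define D where "D = (\<lambda>j x. \<integral>y. g j y * t x y \<partial>euclid n)"
  have D_meas[measurable]: "D j \<in> borel_measurable (euclid n)" for j
    unfolding D_def by measurable
  have D0: "0 \<le> D j x" if "x \<in> space (euclid n)" for j x
    unfolding D_def using t0[OF that] pos(1)[of j] by (intro Bochner_Integration.integral_nonneg) (auto simp: less_imp_le)
  have D_sum: "(\<Sum>j\<in>I. f j x * D j x) = N * f0 x" if x: "x \<in> space (euclid n)" for x
  proof -
    have "(\<Sum>j\<in>I. f j x * D j x) = (\<Sum>j\<in>I. \<integral>y. f j x * (g j y * t x y) \<partial>euclid n)"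
      unfolding D_def by simp
    also have "\<dots> = (\<integral>y. (\<Sum>j\<in>I. f j x * (g j y * t x y)) \<partial>euclid n)"
      by (rule Bochner_Integration.integral_sum[symmetric]) (intro integrable_mult_right int1 x)
    also have "\<dots> = (\<integral>y. N * f0 x * p x y \<partial>euclid n)"
    proof (rule Bochner_Integration.integral_cong[OF refl])
      fix y
      have "(\<Sum>j\<in>I. f j x * (g j y * t x y)) = N * m x y * t x y"
        using N by (simp add: m_eq sum_distrib_right mult.assoc)
      then show "(\<Sum>j\<in>I. f j x * (g j y * t x y)) = N * f0 x * p x y"
        using m_pos[of x y] by (simp add: t_def)
    qed
    also have "\<dots> = N * f0 x"
      using p_int[OF x] by (simp add: has_bochner_integral_iff)
    finally show ?thesis .
  qed
  have f0_int: "has_bochner_integral (euclid n) (\<lambda>x. N * f0 x) N"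
    using has_bochner_integral_mult_right[OF has_gauss_mean_one[of 1 n \<theta>'], of N] by (simp add: f0_def)
  have int2: "integrable (euclid n) (\<lambda>x. f j x * D j x)" if j: "j \<in> I" for j
  proof (rule Bochner_Integration.integrable_bound)
    show "integrable (euclid n) (\<lambda>x. N * f0 x)" using f0_int by (simp add: has_bochner_integral_iff)
    show "AE x in euclid n. norm (f j x * D j x) \<le> norm (N * f0 x)"
    proof (rule AE_I2)
      fix x assume x: "x \<in> space (euclid n)"
      have nn: "0 \<le> f i x * D i x" for i using pos(2)[of i x] D0[OF x, of i] by simp
      then have "f j x * D j x \<le> N * f0 x"
        using member_le_sum[OF j, of "\<lambda>j. f j x * D j x"] I D_sum[OF x] by simp
      then show "norm (f j x * D j x) \<le> norm (N * f0 x)" using nn[of j] by simp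
    qed
  qed measurable
  define d where "d = (\<lambda>j. \<integral>x. f j x * D j x \<partial>euclid n)"
  have "(\<Sum>j\<in>I. d j) = (\<integral>x. (\<Sum>j\<in>I. f j x * D j x) \<partial>euclid n)"
    unfolding d_def by (rule Bochner_Integration.integral_sum[symmetric]) (rule int2)
  also have "\<dots> = (\<integral>x. N * f0 x \<partial>euclid n)"
    by (rule Bochner_Integration.integral_cong[OF refl]) (rule D_sum)
  also have "\<dots> = N" using f0_int by (simp add: has_bochner_integral_iff)
  finally have d_sum: "(\<Sum>j\<in>I. d j) = N" .
  obtain j where j: "j \<in> I" and dj: "d j \<le> 1"
  proof (rule ccontr)
    assume "\<not> thesis"
    then have "\<And>j. j \<in> I \<Longrightarrow> 1 < d j" using that by force
    then have "(\<Sum>j\<in>I. 1) < (\<Sum>j\<in>I. d j)" using I by (intro sum_strict_mono) auto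
    then show False using d_sum by (simp add: N_def)
  qed
  have loss: "ereal (B j x + 1 - D j x) \<le> KL_loss n r (\<theta> j) (p x)" if x: "x \<in> space (euclid n)" for x
    unfolding KL_loss_def
  proof (rule ext_integral_ge)
    have "has_bochner_integral (euclid n) (\<lambda>y. g j y * b j x y + g j y * 1 - g j y * t x y) (B j x + 1 - D j x)"
      unfolding g_def
      using int1[OF j x]
      by (intro has_bochner_integral_diff has_bochner_integral_add B j has_gauss_mean_one r)
         (auto simp: has_bochner_integral_iff D_def g_def)
    then show "has_bochner_integral (euclid n) (\<lambda>y. g j y * (b j x y + 1 - t x y)) (B j x + 1 - D j x)"
      by (simp add: algebra_simps)
    fix y assume y: "y \<in> space (euclid n)"
    show "ereal (g j y * (b j x y + 1 - t x y))
        \<le> ereal (gauss_density n (\<theta> j) r y) * log_ratio (gauss_density n (\<theta> j) r y) (p x y)"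
    proof (cases "p x y = 0")
      case True
      then show ?thesis using pos(1)[of j y] by (simp add: log_ratio_def g_def)
    next
      case False
      then have p: "0 < p x y" using p0[OF x y] by simp
      then have tp: "0 < t x y" using pos(3)[of x] m_pos[of x y] by (simp add: t_def)
      have eq: "g j y / p x y = (g j y * f0 x / m x y) / t x y"
        using p pos(3)[of x] m_pos[of x y] by (simp add: t_def)
      have "ln (g j y / p x y) = ln (g j y * f0 x / m x y) - ln (t x y)"
        unfolding eq using tp pos(1)[of j y] pos(3)[of x] m_pos[of x y] by (intro ln_divide_pos) auto
      moreover have "b j x y \<le> ln (g j y * f0 x / m x y)"
        using b[OF j] by (simp add: g_def f0_def f_def N_def m_def)
      moreover have "ln (t x y) \<le> t x y - 1" using tp by (rule ln_le_minus_one)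
      ultimately have "b j x y + 1 - t x y \<le> ln (g j y / p x y)" by simp
      then show ?thesis
        using pos(1)[of j y] p by (simp add: log_ratio_def g_def)
    qed
  qed
  have "ereal (C + 1 - d j) \<le> KL_risk n r (\<theta> j) p"
    unfolding KL_risk_def
  proof (rule ext_integral_ge)
    have "has_bochner_integral (euclid n) (\<lambda>x. f j x * B j x + f j x * 1 - f j x * D j x) (C + 1 - d j)"
      unfolding f_def
      using int2[OF j]
      by (intro has_bochner_integral_diff has_bochner_integral_add C j has_gauss_mean_one)
         (auto simp: has_bochner_integral_iff d_def f_def)
    then show "has_bochner_integral (euclid n) (\<lambda>x. (B j x + 1 - D j x) * f j x) (C + 1 - d j)"
      by (simp add: algebra_simps)
    fix x assume "x \<in> space (euclid n)"
    from ereal_mult_right_mono[OF loss[OF this], of "ereal (f j x)"]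
    show "ereal ((B j x + 1 - D j x) * f j x) \<le> KL_loss n r (\<theta> j) (p x) * ereal (gauss_density n (\<theta> j) 1 x)"
      using pos(2)[of j x] by (simp add: f_def)
  qed
  moreover have "ereal C \<le> ereal (C + 1 - d j)" using dj by simp
  ultimately show "ereal C \<le> (SUP \<theta>\<in>\<Theta>. KL_risk n r \<theta> p)"
    using SUP_upper[OF I(3)[OF j], of "\<lambda>\<theta>. KL_risk n r \<theta> p"] by (meson order_trans)
qed

section \<open>Lower bound: one spike per block\<close>

lemma block_index:
  fixes b j m s n :: nat
  assumes "b < s" "j < m" "s * m \<le> n"
  shows "b * m + j < s * m" "b * m + j < n" "(b * m + j) div m = b" "(b * m + j) mod m = j"
proof -
  have "b * m + j < (b + 1) * m" using assms by simp
  also have "\<dots> \<le> s * m" using assms by (intro mult_le_mono1) simp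
  finally show "b * m + j < s * m" .
  then show "b * m + j < n" using assms by simp
  show "(b * m + j) div m = b" "(b * m + j) mod m = j" using assms by auto
qed

text \<open>
  The blocks are \<open>{b * m ..< (b + 1) * m}\<close> for \<open>b < s\<close>, and \<open>J b\<close> is the position of the spike within its
  block. The restriction to \<open>{..<n}\<close> makes the vector extensional, hence a point of the parameter space.
\<close>

definition spike_vector :: "nat \<Rightarrow> nat \<Rightarrow> nat \<Rightarrow> real \<Rightarrow> (nat \<Rightarrow> nat) \<Rightarrow> nat \<Rightarrow> real" where
  "spike_vector n s m \<mu> J =
     (\<lambda>i\<in>{..<n}. if i \<in> (\<lambda>b. b * m + J b) ` {..<s} then \<mu> else 0)"

context
  fixes n s m :: nat and \<mu> :: real and J :: "nat \<Rightarrow> nat"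
  assumes J: "J \<in> {..<s} \<rightarrow>\<^sub>E {..<m}" and sm: "s * m \<le> n"
begin

private lemma Jm: "b < s \<Longrightarrow> J b < m"
  using J by auto

lemma inj_on_spikes: "inj_on (\<lambda>b. b * m + J b) {..<s}"
  by (rule inj_on_inverseI[where g = "\<lambda>i. i div m"]) (use block_index[OF _ Jm sm] in auto)

lemma spikes_subset: "(\<lambda>b. b * m + J b) ` {..<s} \<subseteq> {..<n}"
  using block_index[OF _ Jm sm] by auto

lemma spike_vector_at:
  assumes "b < s" "j < m"
  shows "spike_vector n s m \<mu> J (b * m + j) = (if j = J b then \<mu> else 0)"
proof -
  have "b * m + j \<in> (\<lambda>b. b * m + J b) ` {..<s} \<longleftrightarrow> j = J b"
  proof
    assume "b * m + j \<in> (\<lambda>b. b * m + J b) ` {..<s}"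
    then obtain c where c: "c < s" "b * m + j = c * m + J c" by auto
    then have "b = c" "j = J c"
      using block_index[OF assms sm] block_index[OF c(1) Jm[OF c(1)] sm] by metis+
    then show "j = J b" by simp
  qed (use assms in auto)
  then show ?thesis using block_index[OF assms sm] by (simp add: spike_vector_def)
qed

lemma spike_vector_sparse: "spike_vector n s m \<mu> J \<in> sparse_params n s"
proof -
  have "{i \<in> {..<n}. spike_vector n s m \<mu> J i \<noteq> 0} \<subseteq> (\<lambda>b. b * m + J b) ` {..<s}"
    by (auto simp: spike_vector_def split: if_splits)
  from card_mono[OF _ this] card_image_le[of "{..<s}" "\<lambda>b. b * m + J b"]
  have "card {i \<in> {..<n}. spike_vector n s m \<mu> J i \<noteq> 0} \<le> s" by simp
  then show ?thesis by (simp add: sparse_params_def space_euclid) (simp add: spike_vector_def)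
qed

lemma gauss_density_spike_vector:
  assumes v: "0 < v"
  shows "gauss_density n (spike_vector n s m \<mu> J) v x =
    gauss_density n (\<lambda>_. 0) v x * (\<Prod>b<s. exp ((\<mu> * x (b * m + J b) - \<mu>\<^sup>2 / 2) / v))"
proof -
  let ?\<theta> = "spike_vector n s m \<mu> J" and ?S = "(\<lambda>b. b * m + J b) ` {..<s}"
  have "gauss_density n ?\<theta> v x = gauss_density n (\<lambda>_. 0) v x *
      (\<Prod>i<n. exp ((?\<theta> i * x i - (?\<theta> i)\<^sup>2 / 2) / v))"
    by (simp add: gauss_density_def normal_density_shift[OF v, of "?\<theta> _"] prod.distrib)
  also have "(\<Prod>i<n. exp ((?\<theta> i * x i - (?\<theta> i)\<^sup>2 / 2) / v)) =
      (\<Prod>i\<in>?S. exp ((?\<theta> i * x i - (?\<theta> i)\<^sup>2 / 2) / v))"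
    using spikes_subset by (intro prod.mono_neutral_right) (auto simp: spike_vector_def)
  also have "\<dots> = (\<Prod>b<s. exp ((?\<theta> (b * m + J b) * x (b * m + J b) - (?\<theta> (b * m + J b))\<^sup>2 / 2) / v))"
    by (simp add: prod.reindex[OF inj_on_spikes])
  also have "\<dots> = (\<Prod>b<s. exp ((\<mu> * x (b * m + J b) - \<mu>\<^sup>2 / 2) / v))"
    by (intro prod.cong) (auto simp: spike_vector_at Jm)
  finally show ?thesis .
qed

end

text \<open>
  From \<open>u + W \<le> (1 + u) (1 + W)\<close>. It separates the spike's own likelihood ratio \<open>u\<close> from the
  average \<open>W\<close> over the rest of its block, so that each term is a function of single coordinates.
\<close>

lemma ln_add_le:
  fixes K W u :: real
  assumes "0 \<le> K" "0 \<le> W" "0 < u" "u \<le> exp K"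
  shows "ln (u + W) \<le> ln 2 + K + W"
proof -
  have "1 \<le> exp K" using assms by simp
  then have "u + W \<le> 2 * exp K * exp W"
    using exp_ge_add_one_self[of W] assms mult_mono[of 1 "exp K" W W] mult_left_mono[of "1 + W" "exp W" "2 * exp K"]
    by (simp add: algebra_simps) 
  then have "ln (u + W) \<le> ln (2 * exp K * exp W)"
    using assms by (intro ln_mono) auto
  also have "\<dots> = ln 2 + K + W" by (simp add: ln_mult)
  finally show ?thesis .
qed

text \<open>
  By \<open>prod_sum_PiE\<close> the mixture over all spike positions is the null density times a product over the
  blocks of averaged likelihood ratios. In such an average the spike's own term is
  \<open>exp (\<mu> z + \<mu> z' / r)\<close> with centred noises \<open>z\<close> and \<open>z'\<close>, because the choice of \<open>\<mu>\<close> makes the drift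
  \<open>\<mu>\<^sup>2 / 2 * (1 + 1 / r)\<close> cancel against the factor \<open>1 / m\<close>; its logarithm costs \<open>O(\<mu>)\<close>. The other
  terms are likelihood ratios evaluated under the null, so their average has mean at most \<open>1\<close>.
\<close>

lemma minimax_risk_lower:
  fixes r \<mu> :: real and n s m :: nat
  assumes r: "0 < r" and \<mu>: "0 \<le> \<mu>" "\<mu>\<^sup>2 / 2 * (1 + 1 / r) = ln (real m)"
    and m: "1 \<le> m" and sm: "s * m \<le> n"
  shows "ereal (real s * (\<mu>\<^sup>2 / (2 * r) - (2 + 2 * \<mu> * (1 + 1 / r)))) \<le> minimax_risk n r (sparse_params n s)"
proof -
  define I where "I = ({..<s} \<rightarrow>\<^sub>E {..<m})"
  have I: "finite I" "I \<noteq> {}" using m by (auto simp: I_def finite_PiE PiE_eq_empty_iff lessThan_empty_iff)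
  have cardI: "real (card I) = real m ^ s" by (simp add: I_def card_PiE)
  let ?\<theta> = "spike_vector n s m \<mu>"
  \<comment> \<open>\<open>X x b j\<close> and \<open>Y y b j\<close> are the log-likelihood ratios, against the null, of a spike at place \<open>j\<close> of
    block \<open>b\<close>, \<open>W\<close> is the contribution of the spike-free places, and \<open>zx\<close>, \<open>zy\<close> majorise the noise at the spike.\<close>
  define X where "X = (\<lambda>(x::nat\<Rightarrow>real) b j. \<mu> * x (b * m + j) - \<mu>\<^sup>2 / 2)"
  define Y where "Y = (\<lambda>(y::nat\<Rightarrow>real) b j. (\<mu> * y (b * m + j) - \<mu>\<^sup>2 / 2) / r)"
  define W where "W = (\<lambda>J x y b. (\<Sum>j\<in>{..<m} - {J b}. exp (X x b j) * exp (Y y b j)) / m)"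
  define zx where "zx = (\<lambda>J (x::nat\<Rightarrow>real) b. \<mu> * (1 + (x (b * m + J b) - \<mu>)\<^sup>2) / 2)"
  define zy where "zy = (\<lambda>J (y::nat\<Rightarrow>real) b. \<mu> / r * (1 + (y (b * m + J b) - \<mu>)\<^sup>2) / 2)"
  define \<beta> where "\<beta> = (\<lambda>J x y. \<Sum>b<s. Y y b (J b) - (ln 2 + (zx J x b + zy J y b) + W J x y b))"
  define WB where "WB = (\<lambda>J x b. (\<Sum>j\<in>{..<m} - {J b}. exp (X x b j)) / m)"
  define B where "B = (\<lambda>J x. \<Sum>b<s. \<mu>\<^sup>2 / (2 * r) - (ln 2 + (zx J x b + \<mu> / r * (1 + r) / 2) + WB J x b))"
  define C where "C = (\<Sum>b<s. \<mu>\<^sup>2 / (2 * r) - (ln 2 + (\<mu> + \<mu> / r * (1 + r) / 2) + (m - 1) / m))"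
  have "ereal C \<le> minimax_risk n r (sparse_params n s)"
  proof (rule minimax_risk_ge_mixture[OF r I, where \<theta> = ?\<theta> and \<theta>' = "\<lambda>_. 0" and b = \<beta> and B = B])
    fix J assume JI: "J \<in> I"
    then have J: "J \<in> {..<s} \<rightarrow>\<^sub>E {..<m}" by (simp add: I_def)
    have Jm: "J b < m" if "b < s" for b using J that by auto
    show "?\<theta> J \<in> sparse_params n s" by (rule spike_vector_sparse[OF J sm])
    fix x
    { fix y
      let ?f0 = "gauss_density n (\<lambda>_. 0) 1 x" and ?g0 = "gauss_density n (\<lambda>_. 0) r y"
      let ?T = "\<lambda>b. (\<Sum>j<m. exp (X x b j) * exp (Y y b j)) / m"
      have f: "gauss_density n (?\<theta> K) 1 x = ?f0 * (\<Prod>b<s. exp (X x b (K b)))"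
        and g: "gauss_density n (?\<theta> K) r y = ?g0 * (\<Prod>b<s. exp (Y y b (K b)))" if "K \<in> I" for K
        using gauss_density_spike_vector[of K s m n _ \<mu>, OF _ sm] r that
        by (auto simp: I_def X_def Y_def)
      have "(\<Sum>K\<in>I. gauss_density n (?\<theta> K) 1 x * gauss_density n (?\<theta> K) r y) / real (card I) =
          (\<Sum>K\<in>I. ?f0 * ?g0 * (\<Prod>b<s. exp (X x b (K b)) * exp (Y y b (K b)))) / real m ^ s"
        unfolding cardI by (simp add: f g prod.distrib mult_ac)
      also have "\<dots> = ?f0 * ?g0 * ((\<Sum>K\<in>I. \<Prod>b<s. exp (X x b (K b)) * exp (Y y b (K b))) / real m ^ s)"
        by (simp add: sum_distrib_left)
      also have "(\<Sum>K\<in>I. \<Prod>b<s. exp (X x b (K b)) * exp (Y y b (K b))) / real m ^ s = (\<Prod>b<s. ?T b)"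
        unfolding I_def by (subst prod_sum_PiE[symmetric]) (auto simp: prod_dividef)
      finally have mix: "(\<Sum>K\<in>I. gauss_density n (?\<theta> K) 1 x * gauss_density n (?\<theta> K) r y) / real (card I)
          = ?f0 * ?g0 * (\<Prod>b<s. ?T b)" .
      have fg0: "?f0 > 0" "?g0 > 0" using r by (auto simp: gauss_density_pos)
      have T: "0 < ?T b" for b using m by (intro divide_pos_pos sum_pos) (auto simp: lessThan_empty_iff)
      have lnT: "ln (?T b) \<le> ln 2 + (zx J x b + zy J y b) + W J x y b" if b: "b < s" for b
      proof -
        let ?u = "exp (X x b (J b)) * exp (Y y b (J b)) / m"
        have "X x b (J b) + Y y b (J b) = ln m + \<mu> * (x (b * m + J b) - \<mu>) + \<mu> / r * (y (b * m + J b) - \<mu>)"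
          unfolding X_def Y_def \<mu>(2)[symmetric] using r by (simp add: field_simps power2_eq_square)
        then have "exp (X x b (J b)) * exp (Y y b (J b)) =
            exp (ln m + (\<mu> * (x (b * m + J b) - \<mu>) + \<mu> / r * (y (b * m + J b) - \<mu>)))"
          by (simp add: exp_add[symmetric] add.assoc)
        then have "?u = exp (\<mu> * (x (b * m + J b) - \<mu>) + \<mu> / r * (y (b * m + J b) - \<mu>))"
          using m unfolding exp_add by simp
        moreover have "\<mu> * (x (b * m + J b) - \<mu>) \<le> zx J x b"
          unfolding zx_def times_divide_eq_right[symmetric]
          using abs_le_half_one_plus_square[of "x (b * m + J b) - \<mu>"] \<mu> by (intro mult_left_mono) linarith+
        moreover have "\<mu> / r * (y (b * m + J b) - \<mu>) \<le> zy J y b"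
          unfolding zy_def times_divide_eq_right[symmetric, of _ _ 2]
          using abs_le_half_one_plus_square[of "y (b * m + J b) - \<mu>"] \<mu> r
          by (intro mult_left_mono divide_nonneg_pos) linarith+
        ultimately have u: "?u \<le> exp (zx J x b + zy J y b)" by simp
        have "?T b = ?u + W J x y b"
          using sum.remove[of "{..<m}" "J b" "\<lambda>j. exp (X x b j) * exp (Y y b j)"] Jm[OF b]
          by (simp add: W_def add_divide_distrib)
        moreover have "0 \<le> W J x y b" by (simp add: W_def sum_nonneg)
        moreover have "0 \<le> zx J x b + zy J y b" using \<mu> r by (simp add: zx_def zy_def)
        ultimately show ?thesis using u m by (simp only:) (rule ln_add_le, auto)
      qed
      have "\<beta> J x y \<le> (\<Sum>b<s. Y y b (J b) - ln (?T b))"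
        unfolding \<beta>_def by (intro sum_mono diff_left_mono lnT) auto
      also have "\<dots> = ln ((\<Prod>b<s. exp (Y y b (J b))) / (\<Prod>b<s. ?T b))"
      proof -
        have "ln (\<Prod>b<s. ?T b) = (\<Sum>b<s. ln (?T b))"
          by (intro ln_prod finite_lessThan less_imp_neq[OF T, THEN not_sym])
        moreover have "ln ((\<Prod>b<s. exp (Y y b (J b))) / (\<Prod>b<s. ?T b)) =
            ln (\<Prod>b<s. exp (Y y b (J b))) - ln (\<Prod>b<s. ?T b)"
          by (intro ln_divide_pos prod_pos T) auto
        moreover have "ln (\<Prod>b<s. exp (Y y b (J b))) = (\<Sum>b<s. Y y b (J b))"
          by (simp add: exp_sum[symmetric])
        ultimately show ?thesis by (simp only: sum_subtractf)
      qed
      also have "(\<Prod>b<s. exp (Y y b (J b))) / (\<Prod>b<s. ?T b) =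
          gauss_density n (?\<theta> J) r y * ?f0 / (?f0 * ?g0 * (\<Prod>b<s. ?T b))"
        using fg0 by (simp add: g[OF JI])
      finally show "\<beta> J x y \<le> ln (gauss_density n (?\<theta> J) r y * ?f0 /
          ((\<Sum>K\<in>I. gauss_density n (?\<theta> K) 1 x * gauss_density n (?\<theta> K) r y) / real (card I)))"
        unfolding mix .
    }
    have spike: "?\<theta> J (b * m + J b) = \<mu>" if "b < s" for b
      using spike_vector_at[OF J sm that Jm[OF that]] by simp
    have nospike: "?\<theta> J (b * m + j) = 0" if "b < s" "j \<in> {..<m} - {J b}" for b j
      using spike_vector_at[OF J sm that(1), of j] that by simp
    have at: "has_gauss_mean n (?\<theta> J) v (\<lambda>x. h (x (b * m + j))) c"
      if "0 < v" "b < s" "j < m" "has_normal_mean (?\<theta> J (b * m + j)) v h c" for v b j h c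
      using has_gauss_mean_coord[of v "b * m + j" n "?\<theta> J" h c] block_index(2)[OF that(2,3) sm] that by simp
    show "has_gauss_mean n (?\<theta> J) r (\<beta> J x) (B J x)"
      unfolding \<beta>_def B_def
    proof (rule has_gauss_mean_sum)
      fix b assume "b \<in> {..<s}"
      then have b: "b < s" by simp
      have 1: "has_normal_mean \<mu> r (\<lambda>t. (\<mu> * t - \<mu>\<^sup>2 / 2) / r - (ln 2 + (zx J x b + \<mu> / r * (1 + (t - \<mu>)\<^sup>2) / 2)))
          (\<mu>\<^sup>2 / (2 * r) - (ln 2 + (zx J x b + \<mu> / r * (1 + r) / 2)))"
        by (rule has_normal_mean_cong[OF has_normal_mean_quadratic[OF r, of _
            "\<mu>\<^sup>2 / (2 * r) - (ln 2 + (zx J x b + \<mu> / r / 2))" "\<mu> / r" "- \<mu> / r / 2"]])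
           (use r in \<open>auto simp: field_simps power2_eq_square\<close>)
      have 2: "has_gauss_mean n (?\<theta> J) r (\<lambda>y. exp (X x b j) * exp (Y y b j)) (exp (X x b j))"
        if j: "j \<in> {..<m} - {J b}" for j
      proof -
        have "has_gauss_mean n (?\<theta> J) r (\<lambda>y. exp (Y y b j)) 1"
          unfolding Y_def
          using at[OF r b, of j "\<lambda>t. exp ((\<mu> * t - \<mu>\<^sup>2 / 2) / r)" 1]
            has_normal_mean_exp_tilt[OF r, of \<mu>] nospike[OF b j] j by simp
        from has_bochner_integral_mult_right[OF this, of "exp (X x b j)"]
        show ?thesis by (simp add: mult_ac)
      qed
      have 3: "has_gauss_mean n (?\<theta> J) r (\<lambda>y. W J x y b) (WB J x b)"
        unfolding W_def WB_def times_divide_eq_right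
        by (intro has_bochner_integral_divide_zero has_gauss_mean_sum 2)
      show "has_gauss_mean n (?\<theta> J) r (\<lambda>y. Y y b (J b) - (ln 2 + (zx J x b + zy J y b) + W J x y b))
          (\<mu>\<^sup>2 / (2 * r) - (ln 2 + (zx J x b + \<mu> / r * (1 + r) / 2) + WB J x b))"
        using has_gauss_mean_diff[OF at[where b = b and j = "J b", unfolded spike[OF b], OF r b Jm[OF b] 1] 3]
        by (simp add: Y_def zy_def add.assoc diff_diff_eq)
    qed
    show "has_gauss_mean n (?\<theta> J) 1 (B J) C"
      unfolding B_def C_def
    proof (rule has_gauss_mean_sum)
      fix b assume "b \<in> {..<s}"
      then have b: "b < s" by simp
      have 1: "has_normal_mean \<mu> 1 (\<lambda>t. \<mu>\<^sup>2 / (2 * r) - (ln 2 + (\<mu> * (1 + (t - \<mu>)\<^sup>2) / 2 + \<mu> / r * (1 + r) / 2)))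
          (\<mu>\<^sup>2 / (2 * r) - (ln 2 + (\<mu> + \<mu> / r * (1 + r) / 2)))"
        by (rule has_normal_mean_cong[OF has_normal_mean_quadratic[OF zero_less_one, of _
            "\<mu>\<^sup>2 / (2 * r) - (ln 2 + (\<mu> / 2 + \<mu> / r * (1 + r) / 2))" 0 "- \<mu> / 2"]])
           (use r in \<open>auto simp: field_simps power2_eq_square\<close>)
      have 2: "has_gauss_mean n (?\<theta> J) 1 (\<lambda>x. exp (X x b j)) 1" if j: "j \<in> {..<m} - {J b}" for j
        unfolding X_def
        using at[OF zero_less_one b, of j "\<lambda>t. exp ((\<mu> * t - \<mu>\<^sup>2 / 2) / 1)" 1]
          has_normal_mean_exp_tilt[OF zero_less_one, of \<mu>] nospike[OF b j] j by simp
      have 3: "has_gauss_mean n (?\<theta> J) 1 (\<lambda>x. WB J x b) ((\<Sum>j\<in>{..<m} - {J b}. 1) / m)"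
        unfolding WB_def times_divide_eq_right
        by (intro has_bochner_integral_divide_zero has_gauss_mean_sum 2)
      show "has_gauss_mean n (?\<theta> J) 1 (\<lambda>x. \<mu>\<^sup>2 / (2 * r) - (ln 2 + (zx J x b + \<mu> / r * (1 + r) / 2) + WB J x b))
          (\<mu>\<^sup>2 / (2 * r) - (ln 2 + (\<mu> + \<mu> / r * (1 + r) / 2) + (m - 1) / m))"
        using has_gauss_mean_diff[OF at[where b = b and j = "J b", unfolded spike[OF b], OF zero_less_one b Jm[OF b] 1] 3] Jm[OF b]
        by (simp add: zx_def add.assoc diff_diff_eq card_Diff_singleton)
    qed
  qed
  moreover have "real s * (\<mu>\<^sup>2 / (2 * r) - (2 + 2 * \<mu> * (1 + 1 / r))) \<le> C"
  proof -
    define k where "k = \<mu> * (1 + 1 / r)"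
    have "ln 2 \<le> (1::real)" using ln_le_minus_one[of 2] by simp
    moreover have "real (m - 1) / real m \<le> 1" using m by simp
    moreover have "\<mu> / r * (1 + r) / 2 = k / 2" using r by (simp add: k_def field_simps)
    moreover have "0 \<le> k" "\<mu> \<le> k" using r \<mu>(1) by (auto simp: k_def algebra_simps)
    moreover have "2 * \<mu> * (1 + 1 / r) = 2 * k" by (simp add: k_def)
    ultimately have "\<mu>\<^sup>2 / (2 * r) - (2 + 2 * \<mu> * (1 + 1 / r))
        \<le> \<mu>\<^sup>2 / (2 * r) - (ln 2 + (\<mu> + \<mu> / r * (1 + r) / 2) + (m - 1) / m)"
      by linarith
    then show ?thesis unfolding C_def by (simp add: mult_left_mono)
  qed
  ultimately show ?thesis by (meson ereal_less_eq(3) order_trans)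
qed

section \<open>Upper bound: a coordinatewise Bayes predictive density\<close>

text \<open>
  For a product estimator the logarithm turns the loss into a sum over the coordinates, each of which is
  averaged separately.
\<close>

lemma KL_risk_product_le:
  assumes r: "0 < r" and q: "\<And>x y. 0 < q x y"
    and b: "\<And>i x y. i < n \<Longrightarrow> ln (normal_density (\<theta> i) (sqrt r) y / q x y) \<le> b i x y"
    and B: "\<And>i x. i < n \<Longrightarrow> has_normal_mean (\<theta> i) r (b i x) (B i x)"
    and C: "\<And>i. i < n \<Longrightarrow> has_normal_mean (\<theta> i) 1 (B i) (C i)"
  shows "KL_risk n r \<theta> (\<lambda>x y. \<Prod>i<n. q (x i) (y i)) \<le> ereal (\<Sum>i<n. C i)"
proof -
  let ?p = "\<lambda>x y. \<Prod>i<n. q (x i) (y i)"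
  have loss: "KL_loss n r \<theta> (?p x) \<le> ereal (\<Sum>i<n. B i (x i))" for x
    unfolding KL_loss_def
  proof (rule ext_integral_le)
    show "has_gauss_mean n \<theta> r (\<lambda>y. \<Sum>i<n. b i (x i) (y i)) (\<Sum>i<n. B i (x i))"
      by (intro has_gauss_mean_sum has_gauss_mean_coord) (auto intro: r B)
    fix y
    have "ln (gauss_density n \<theta> r y / ?p x y) = ln (\<Prod>i<n. normal_density (\<theta> i) (sqrt r) (y i) / q (x i) (y i))"
      by (simp add: gauss_density_def prod_dividef)
    also have "\<dots> = (\<Sum>i<n. ln (normal_density (\<theta> i) (sqrt r) (y i) / q (x i) (y i)))"
      using r q normal_density_pos[of "sqrt r"] by (intro ln_prod) (auto simp: less_imp_neq[THEN not_sym])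
    also have "\<dots> \<le> (\<Sum>i<n. b i (x i) (y i))"
      by (intro sum_mono b) auto
    finally have le: "ln (gauss_density n \<theta> r y / ?p x y) \<le> (\<Sum>i<n. b i (x i) (y i))" .
    have "?p x y > 0" by (intro prod_pos) (auto intro: q)
    then have "log_ratio (gauss_density n \<theta> r y) (?p x y) = ereal (ln (gauss_density n \<theta> r y / ?p x y))"
      by (simp only: log_ratio_def less_imp_neq[THEN not_sym] if_False)
    then show "ereal (gauss_density n \<theta> r y) * log_ratio (gauss_density n \<theta> r y) (?p x y)
        \<le> ereal (gauss_density n \<theta> r y * (\<Sum>i<n. b i (x i) (y i)))"
      using mult_left_mono[OF le less_imp_le[OF gauss_density_pos[OF r, of n \<theta> y]]]
      by simp
  qed
  show ?thesis
    unfolding KL_risk_def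
  proof (rule ext_integral_le)
    show "has_gauss_mean n \<theta> 1 (\<lambda>x. \<Sum>i<n. B i (x i)) (\<Sum>i<n. C i)"
      by (intro has_gauss_mean_sum has_gauss_mean_coord C) auto
    fix x
    show "KL_loss n r \<theta> (?p x) * ereal (gauss_density n \<theta> 1 x)
        \<le> ereal (gauss_density n \<theta> 1 x * (\<Sum>i<n. B i (x i)))"
      using ereal_mult_right_mono[OF loss[of x], of "ereal (gauss_density n \<theta> 1 x)"]
        gauss_density_pos[of 1 n \<theta> x]
      by (simp add: mult.commute)
  qed
qed

text \<open>
  A one-dimensional risk bound in the form of a witness: an explicit majorant of the logarithmic loss and its
  iterated mean. This avoids proving that the one-dimensional risk itself exists.
\<close>

definition coord_risk_le :: "real \<Rightarrow> (real \<Rightarrow> real \<Rightarrow> real) \<Rightarrow> real \<Rightarrow> real \<Rightarrow> bool" where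
  "coord_risk_le r q a c \<longleftrightarrow>
     (\<exists>b B c'. (\<forall>x y. ln (normal_density a (sqrt r) y / q x y) \<le> b x y) \<and>
        (\<forall>x. has_normal_mean a r (b x) (B x)) \<and> has_normal_mean a 1 B c' \<and> c' \<le> c)"

lemma coord_risk_leI:
  assumes "\<And>x y. ln (normal_density a (sqrt r) y / q x y) \<le> b x y"
    and "\<And>x. has_normal_mean a r (b x) (B x)" "has_normal_mean a 1 B c'" "c' \<le> c"
  shows "coord_risk_le r q a c"
  unfolding coord_risk_le_def
  by (intro exI[of _ b] exI[of _ B] exI[of _ c'] conjI allI assms)

lemma coord_risk_weaken:
  assumes "coord_risk_le r q a c" "c \<le> d"
  shows "coord_risk_le r q a d"
proof -
  from assms(1) obtain b B c' where
    b: "\<forall>x y. ln (normal_density a (sqrt r) y / q x y) \<le> b x y"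
    and B: "\<forall>x. has_normal_mean a r (b x) (B x)" and c': "has_normal_mean a 1 B c'" "c' \<le> c"
    unfolding coord_risk_le_def by (elim exE conjE)
  show ?thesis
    by (rule coord_risk_leI[OF spec[OF spec[OF b]] spec[OF B] c'(1)]) (use c'(2) assms(2) in simp)
qed

lemma KL_risk_product_le_coord_risk:
  assumes r: "0 < r" and q: "\<And>x y. 0 < q x y"
    and c: "\<And>i. i < n \<Longrightarrow> coord_risk_le r q (\<theta> i) (c i)"
  shows "KL_risk n r \<theta> (\<lambda>x y. \<Prod>i<n. q (x i) (y i)) \<le> ereal (\<Sum>i<n. c i)"
proof -
  let ?P = "\<lambda>a c w. (\<forall>x y. ln (normal_density a (sqrt r) y / q x y) \<le> fst w x y) \<and>
    (\<forall>x. has_normal_mean a r (fst w x) (fst (snd w) x)) \<and>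
    has_normal_mean a 1 (fst (snd w)) (snd (snd w)) \<and> snd (snd w) \<le> c"
  have "\<forall>i\<in>{..<n}. \<exists>w. ?P (\<theta> i) (c i) w"
    using c by (simp add: coord_risk_le_def)
  from bchoice[OF this] obtain w where "\<forall>i\<in>{..<n}. ?P (\<theta> i) (c i) (w i)" ..
  then have w: "?P (\<theta> i) (c i) (w i)" if "i < n" for i
    using that by blast
  define b where "b = (\<lambda>i. fst (w i))"
  define B where "B = (\<lambda>i. fst (snd (w i)))"
  define c' where "c' = (\<lambda>i. snd (snd (w i)))"
  have *: "\<And>i x y. i < n \<Longrightarrow> ln (normal_density (\<theta> i) (sqrt r) y / q x y) \<le> b i x y"
    "\<And>i x. i < n \<Longrightarrow> has_normal_mean (\<theta> i) r (b i x) (B i x)"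
    "\<And>i. i < n \<Longrightarrow> has_normal_mean (\<theta> i) 1 (B i) (c' i)" "\<And>i. i < n \<Longrightarrow> c' i \<le> c i"
    unfolding b_def B_def c'_def using w by blast+
  have "KL_risk n r \<theta> (\<lambda>x y. \<Prod>i<n. q (x i) (y i)) \<le> ereal (\<Sum>i<n. c' i)"
    by (rule KL_risk_product_le[OF r q *(1-3)])
  also have "\<dots> \<le> ereal (\<Sum>i<n. c i)"
    by (auto intro!: sum_mono *(4))
  finally show ?thesis .
qed

text \<open>
  The posterior mass of \<open>0\<close> given \<open>x\<close> for the improper prior \<open>\<delta>\<^sub>0\<close> plus \<open>\<eta> / sqrt (2 \<pi>)\<close> times Lebesgue
  measure: the marginal densities of \<open>x\<close> under the two parts are \<open>exp (- x\<^sup>2 / 2) / sqrt (2 \<pi>)\<close> and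
  \<open>\<eta> / sqrt (2 \<pi>)\<close>.
\<close>

definition null_weight :: "real \<Rightarrow> real \<Rightarrow> real" where
  "null_weight \<eta> x = 1 / (1 + \<eta> * exp (x\<^sup>2 / 2))"

text \<open>
  The predictive density of that prior; \<open>N(x, 1 + r)\<close> is the predictive density of the flat part.
\<close>

definition mix_density :: "real \<Rightarrow> real \<Rightarrow> real \<Rightarrow> real \<Rightarrow> real" where
  "mix_density \<eta> r x y = null_weight \<eta> x * normal_density 0 (sqrt r) y +
     (1 - null_weight \<eta> x) * normal_density x (sqrt (1 + r)) y"

lemma ln_one_plus_exp_le:
  fixes z k :: real
  assumes "z \<le> k" "0 \<le> k"
  shows "ln (1 + exp z) \<le> 1 + k"
proof -
  have "1 + exp z \<le> 2 * exp k"
    using assms by (smt (verit) exp_ge_zero exp_le_cancel_iff exp_ge_add_one_self)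
  then have "ln (1 + exp z) \<le> ln (2 * exp k)"
    by (intro ln_mono) (auto intro: add_pos_pos)
  also have "\<dots> = ln 2 + k" by (simp add: ln_mult)
  also have "\<dots> \<le> 1 + k" using ln_le_minus_one[of 2] by simp
  finally show ?thesis .
qed

text \<open>
  Subadditivity of \<open>t \<mapsto> t powr a\<close> gives \<open>(1 + t) powr a \<le> 1 + t powr a\<close>.
\<close>

lemma ln_one_plus_le_powr:
  fixes t a :: real
  assumes t: "0 < t" and a: "0 < a" "a \<le> 1"
  shows "ln (1 + t) \<le> t powr a / a"
proof -
  have p: "(1 + t) powr a \<le> 1 + t powr a"
  proof -
    have "(1 / (1 + t)) \<le> (1 / (1 + t)) powr a"
      using powr_mono'[of a 1 "1 / (1 + t)"] t a by simp
    moreover have "t / (1 + t) \<le> (t / (1 + t)) powr a"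
      using powr_mono'[of a 1 "t / (1 + t)"] t a by simp
    moreover have "1 / (1 + t) + t / (1 + t) = 1"
      using t by (simp add: field_simps)
    ultimately have "1 \<le> (1 / (1 + t)) powr a + (t / (1 + t)) powr a" by linarith
    also have "\<dots> = (1 + t powr a) / (1 + t) powr a"
      using t by (simp add: powr_divide add_divide_distrib)
    finally show ?thesis using t by (simp add: le_divide_eq)
  qed
  have "a * ln (1 + t) = ln ((1 + t) powr a)" by simp
  also have "\<dots> \<le> ln (1 + t powr a)" using p t by (intro ln_mono) auto
  also have "\<dots> \<le> t powr a" by (rule ln_add_one_self_le_self) simp
  finally show ?thesis using a by (simp add: field_simps)
qed

context
  fixes \<eta> r :: real
  assumes \<eta>: "0 < \<eta>" and r: "0 < r"
begin

lemma null_weight_bounds: "0 < null_weight \<eta> x" "null_weight \<eta> x < 1"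
  using \<eta> by (auto simp: null_weight_def add_pos_pos divide_less_eq)

lemma mix_density_pos: "0 < mix_density \<eta> r x y"
  unfolding mix_density_def using null_weight_bounds[of x] r
  by (intro add_pos_pos mult_pos_pos normal_density_pos) auto

lemma mix_density_measurable[measurable]:
  assumes [measurable]: "f \<in> borel_measurable M" "g \<in> borel_measurable M"
  shows "(\<lambda>z. mix_density \<eta> r (f z) (g z)) \<in> borel_measurable M"
  unfolding mix_density_def null_weight_def normal_density_def by measurable

lemma nn_integral_mix_density: "(\<integral>\<^sup>+ y. ennreal (mix_density \<eta> r x y) \<partial>lborel) = 1"
proof -
  have "has_bochner_integral lborel (mix_density \<eta> r x)
      (null_weight \<eta> x * 1 + (1 - null_weight \<eta> x) * 1)"
    unfolding mix_density_def using has_normal_mean_one[of r 0] has_normal_mean_one[of "1 + r" x] r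
    by (intro has_bochner_integral_add has_bochner_integral_mult_right) auto
  then show ?thesis
    using nn_integral_eq_integral[of lborel "mix_density \<eta> r x"] mix_density_pos
    by (auto simp: has_bochner_integral_iff less_imp_le)
qed

lemma product_mix_density_estimator:
  "(\<lambda>x y. \<Prod>i<n. mix_density \<eta> r (x i) (y i)) \<in> predictive_density_estimators n"
proof -
  have "(\<lambda>(x, y). \<Prod>i<n. mix_density \<eta> r (x i) (y i)) \<in> borel_measurable (euclid n \<Otimes>\<^sub>M euclid n)"
    unfolding split_beta
    by (intro borel_measurable_prod mix_density_measurable
        measurable_compose[OF measurable_fst measurable_coord]
        measurable_compose[OF measurable_snd measurable_coord]) auto
  moreover have "(\<integral>\<^sup>+ y. ennreal (\<Prod>i<n. mix_density \<eta> r (x i) (y i)) \<partial>euclid n) = 1" for x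
    using euclid.product_nn_integral_prod[of "{..<n}" "\<lambda>i t. ennreal (mix_density \<eta> r (x i) t)"]
    by (simp add: euclid_def prod_ennreal[symmetric] less_imp_le[OF mix_density_pos] nn_integral_mix_density)
  ultimately show ?thesis
    by (auto simp: predictive_density_estimators_def intro!: prod_nonneg less_imp_le[OF mix_density_pos])
qed

lemma ln_ratio_le_null:
  "ln (normal_density a (sqrt r) y / mix_density \<eta> r x y) \<le>
     ln (1 + \<eta> * exp (x\<^sup>2 / 2)) + (a * y - a\<^sup>2 / 2) / r"
proof -
  let ?w = "null_weight \<eta> x" and ?g = "normal_density 0 (sqrt r) y"
  have g: "0 < ?g" "0 < normal_density a (sqrt r) y" using r by (auto simp: normal_density_pos)
  have w: "0 < ?w" "?w < 1" by (rule null_weight_bounds)+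
  have "?w * ?g \<le> mix_density \<eta> r x y"
    unfolding mix_density_def using w by simp
  then have "normal_density a (sqrt r) y / mix_density \<eta> r x y \<le> normal_density a (sqrt r) y / (?w * ?g)"
    using g w by (intro divide_left_mono mult_pos_pos mix_density_pos) auto
  also have "\<dots> = (1 + \<eta> * exp (x\<^sup>2 / 2)) * exp ((a * y - a\<^sup>2 / 2) / r)"
    using g by (simp add: normal_density_shift[OF r, of a] null_weight_def)
  finally have "ln (normal_density a (sqrt r) y / mix_density \<eta> r x y) \<le>
      ln ((1 + \<eta> * exp (x\<^sup>2 / 2)) * exp ((a * y - a\<^sup>2 / 2) / r))"
    using g mix_density_pos[of x y] by (intro ln_mono) auto
  also have "\<dots> = ln (1 + \<eta> * exp (x\<^sup>2 / 2)) + (a * y - a\<^sup>2 / 2) / r"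
    using \<eta> by (subst ln_mult_pos) (auto intro: add_pos_pos)
  finally show ?thesis .
qed

lemma ln_ratio_le_flat:
  "ln (normal_density a (sqrt r) y / mix_density \<eta> r x y) \<le>
     ln (1 + 1 / (\<eta> * exp (x\<^sup>2 / 2))) + ln (1 + 1 / r) / 2 - (y - a)\<^sup>2 / (2 * r) + (y - x)\<^sup>2 / (2 * (1 + r))"
proof -
  let ?w = "null_weight \<eta> x" and ?g = "normal_density x (sqrt (1 + r)) y" and ?e = "\<eta> * exp (x\<^sup>2 / 2)"
  have g: "0 < ?g" "0 < normal_density a (sqrt r) y" using r by (auto simp: normal_density_pos)
  have w: "0 < ?w" "?w < 1" by (rule null_weight_bounds)+
  have e: "0 < ?e" using \<eta> by simp
  have w1: "1 / (1 - ?w) = 1 + 1 / ?e"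
  proof -
    have "1 / (1 - 1 / (1 + t)) = 1 + 1 / t" if "0 < t" for t :: real
      using that by (simp add: field_simps)
    from this[OF e] show ?thesis unfolding null_weight_def .
  qed
  have "(1 - ?w) * ?g \<le> mix_density \<eta> r x y"
    unfolding mix_density_def using w r by simp
  then have "normal_density a (sqrt r) y / mix_density \<eta> r x y \<le> normal_density a (sqrt r) y / ((1 - ?w) * ?g)"
    using g w by (intro divide_left_mono mult_pos_pos mix_density_pos) auto
  also have "\<dots> = (1 + 1 / ?e) * (normal_density a (sqrt r) y / ?g)"
    unfolding w1[symmetric] by simp
  finally have "ln (normal_density a (sqrt r) y / mix_density \<eta> r x y) \<le>
      ln ((1 + 1 / ?e) * (normal_density a (sqrt r) y / ?g))"
    using g mix_density_pos[of x y] by (intro ln_mono) auto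
  also have "\<dots> = ln (1 + 1 / ?e) + (ln (normal_density a (sqrt r) y) - ln ?g)"
    using e g by (subst ln_mult_pos) (auto intro: add_pos_pos simp: ln_divide_pos)
  also have "\<dots> = ln (1 + 1 / ?e) + ((ln (2 * pi * (1 + r)) - ln (2 * pi * r)) / 2
      - (y - a)\<^sup>2 / (2 * r) + (y - x)\<^sup>2 / (2 * (1 + r)))"
    using r by (simp add: ln_normal_density diff_divide_distrib)
  also have "ln (2 * pi * (1 + r)) - ln (2 * pi * r) = ln (1 + 1 / r)"
  proof -
    have "ln (2 * pi * (1 + r)) - ln (2 * pi * r) = ln ((2 * pi * (1 + r)) / (2 * pi * r))"
      using r by (intro ln_divide_pos[symmetric]) auto
    also have "(2 * pi * (1 + r)) / (2 * pi * r) = 1 + 1 / r" using r by (simp add: field_simps)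
    finally show ?thesis .
  qed
  finally show ?thesis by simp
qed

text \<open>
  The bound \<open>ln (1 + u) \<le> u powr \<alpha> / \<alpha>\<close> is used for \<open>u = \<eta> exp (x\<^sup>2 / 2)\<close>, which itself has infinite mean.
  Its right-hand side has mean \<open>\<eta> powr \<alpha> / (\<alpha> sqrt (1 - \<alpha>))\<close>. The exponent \<open>\<alpha> = 1 - 1 / L\<close> balances the two
  effects: \<open>\<eta> powr \<alpha> = exp 1 * \<eta>\<close> and \<open>1 / sqrt (1 - \<alpha>) = sqrt L\<close>.
\<close>

lemma coord_risk_zero:
  assumes L: "2 \<le> L" and \<eta>L: "\<eta> = exp (- L)"
  shows "coord_risk_le r (mix_density \<eta> r) 0 (6 * \<eta> * sqrt L)"
proof (rule coord_risk_leI)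
  define \<alpha> where "\<alpha> = 1 - 1 / L"
  have \<alpha>: "1 / 2 \<le> \<alpha>" "\<alpha> < 1" using L by (auto simp: \<alpha>_def field_simps)
  define B where "B = (\<lambda>x::real. \<eta> powr \<alpha> / \<alpha> * exp (\<alpha> * x\<^sup>2 / 2))"
  fix x y
  have "ln (1 + \<eta> * exp (x\<^sup>2 / 2)) \<le> (\<eta> * exp (x\<^sup>2 / 2)) powr \<alpha> / \<alpha>"
    using \<alpha> \<eta> by (intro ln_one_plus_le_powr) auto
  also have "\<dots> = B x"
    using \<eta> by (simp add: B_def powr_mult exp_powr_real mult.commute)
  finally show "ln (normal_density 0 (sqrt r) y / mix_density \<eta> r x y) \<le> B x"
    using ln_ratio_le_null[of 0 y x] by simp
  show "has_normal_mean 0 r (\<lambda>y. B x) (B x)"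
    using has_bochner_integral_mult_left[OF has_normal_mean_one[OF r, of 0], of "B x"] by simp
  show "has_normal_mean 0 1 B (\<eta> powr \<alpha> / \<alpha> * (1 / sqrt (1 - \<alpha>)))"
    using has_bochner_integral_mult_left[OF has_normal_mean_exp_square[of \<alpha>], of "\<eta> powr \<alpha> / \<alpha>"] \<alpha>
    by (simp add: B_def mult_ac)
  have "\<eta> powr \<alpha> = exp 1 * \<eta>"
    using L by (simp add: \<eta>L exp_powr_real \<alpha>_def algebra_simps exp_add[symmetric] flip: exp_diff)
  also have "\<dots> \<le> 3 * \<eta>" using \<eta> exp_le by simp
  also have "\<dots> = 6 * \<eta> * (1 / 2)" by simp
  also have "\<dots> \<le> 6 * \<eta> * \<alpha>" using \<alpha> \<eta> by (intro mult_left_mono) auto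
  finally have "\<eta> powr \<alpha> / \<alpha> \<le> 6 * \<eta>"
    using \<alpha> by (simp add: divide_le_eq)
  moreover have "1 / sqrt (1 - \<alpha>) = sqrt L"
    by (simp add: \<alpha>_def real_sqrt_divide)
  ultimately show "\<eta> powr \<alpha> / \<alpha> * (1 / sqrt (1 - \<alpha>)) \<le> 6 * \<eta> * sqrt L"
    using L by (simp only:) (rule mult_right_mono, auto)
qed

text \<open>
  Below the critical height the component \<open>N(0, r)\<close> is used. Its loss has mean \<open>a\<^sup>2 / (2 r)\<close>, and minus the
  logarithm of its weight exceeds a constant only through the noise, as \<open>x\<^sup>2 / 2 - L\<close> has nonpositive drift.
\<close>

lemma coord_risk_small:
  assumes L: "0 \<le> L" and \<eta>L: "\<eta> = exp (- L)" and a: "a\<^sup>2 / 2 \<le> r / (1 + r) * L"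
  shows "coord_risk_le r (mix_density \<eta> r) a (L / (1 + r) + sqrt (2 * L) + 3 / 2)"
proof (rule coord_risk_leI)
  let ?A = "sqrt (2 * L)"
  have "r / (1 + r) * L \<le> 1 * L" using r L by (intro mult_right_mono) auto
  then have aL: "a\<^sup>2 / 2 \<le> L" using a by linarith
  then have aA: "\<bar>a\<bar> \<le> ?A" by (intro real_le_rsqrt) (simp add: mult.commute)
  fix x y
  let ?B0 = "1 + (?A * ((1 + (x - a)\<^sup>2) / 2) + (x - a)\<^sup>2 / 2)"
  have "a * (x - a) \<le> ?A * ((1 + (x - a)\<^sup>2) / 2)"
  proof -
    have "a * (x - a) \<le> \<bar>a\<bar> * \<bar>x - a\<bar>" by (simp add: abs_mult[symmetric])
    also have "\<dots> \<le> ?A * ((1 + (x - a)\<^sup>2) / 2)"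
      using aA L abs_le_half_one_plus_square by (intro mult_mono) auto
    finally show ?thesis .
  qed
  moreover have "x\<^sup>2 / 2 - L = (a\<^sup>2 / 2 - L) + a * (x - a) + (x - a)\<^sup>2 / 2"
    by (simp add: field_simps power2_eq_square)
  ultimately have "x\<^sup>2 / 2 - L \<le> ?A * ((1 + (x - a)\<^sup>2) / 2) + (x - a)\<^sup>2 / 2"
    using aL by linarith
  moreover have "\<eta> * exp (x\<^sup>2 / 2) = exp (x\<^sup>2 / 2 - L)"
    using exp_add[of "- L" "x\<^sup>2 / 2"] by (simp add: \<eta>L)
  moreover have "0 \<le> ?A * ((1 + (x - a)\<^sup>2) / 2) + (x - a)\<^sup>2 / 2"
    using L by (intro add_nonneg_nonneg mult_nonneg_nonneg) auto
  ultimately have "ln (1 + \<eta> * exp (x\<^sup>2 / 2)) \<le> ?B0"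
    using ln_one_plus_exp_le by simp
  moreover have "(a * y - a\<^sup>2 / 2) / r = a\<^sup>2 / (2 * r) + a / r * (y - a)"
    using r by (simp add: field_simps power2_eq_square)
  ultimately show "ln (normal_density a (sqrt r) y / mix_density \<eta> r x y) \<le> ?B0 + a\<^sup>2 / (2 * r) + a / r * (y - a)"
    using ln_ratio_le_null[of a y x] by linarith
  show "has_normal_mean a r (\<lambda>y. ?B0 + a\<^sup>2 / (2 * r) + a / r * (y - a)) (?B0 + a\<^sup>2 / (2 * r))"
    using has_normal_mean_quadratic[OF r, of a "?B0 + a\<^sup>2 / (2 * r)" "a / r" 0] by simp
  show "has_normal_mean a 1 (\<lambda>x. 1 + (?A * ((1 + (x - a)\<^sup>2) / 2) + (x - a)\<^sup>2 / 2) + a\<^sup>2 / (2 * r))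
      (1 + ?A + 1 / 2 + a\<^sup>2 / (2 * r))"
    by (rule has_normal_mean_cong[OF has_normal_mean_quadratic[OF zero_less_one, of _
          "1 + ?A / 2 + a\<^sup>2 / (2 * r)" 0 "?A / 2 + 1 / 2"]])
       (auto simp: field_simps)
  have "a\<^sup>2 / (2 * r) \<le> L / (1 + r)"
    using a r by (simp add: field_simps)
  then show "1 + ?A + 1 / 2 + a\<^sup>2 / (2 * r) \<le> L / (1 + r) + ?A + 3 / 2" by simp
qed

text \<open>
  Above the critical height the component \<open>N(x, 1 + r)\<close> is used, whose loss has the constant mean
  \<open>ln (1 + 1 / r) / 2\<close>. Minus the logarithm of its weight is about the positive part of \<open>L - x\<^sup>2 / 2\<close>; to keep the noise term
  bounded for large \<open>\<bar>a\<bar>\<close>, \<open>x\<^sup>2\<close> is compared with the critical height \<open>A0\<close> instead of with \<open>a\<close>.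
\<close>

lemma coord_risk_large:
  assumes L: "0 \<le> L" and \<eta>L: "\<eta> = exp (- L)" and a: "r / (1 + r) * L \<le> a\<^sup>2 / 2"
  shows "coord_risk_le r (mix_density \<eta> r) a (L / (1 + r) + sqrt (2 * L) + 1 + ln (1 + 1 / r) / 2)"
proof (rule coord_risk_leI)
  let ?A = "sqrt (2 * L)"
  define A0 where "A0 = sqrt (2 * (r / (1 + r) * L))"
  have w: "0 \<le> r / (1 + r) * L" "r / (1 + r) * L \<le> L"
    using L r mult_right_mono[of "r / (1 + r)" 1 L] by auto
  have "sqrt (2 * w) \<le> \<bar>b\<bar> \<and> 0 \<le> sqrt (2 * w) \<and> (sqrt (2 * w))\<^sup>2 / 2 = w \<and> sqrt (2 * w) \<le> ?A"
    if "0 \<le> w" "w \<le> L" "w \<le> b\<^sup>2 / 2" for w b :: real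
    using that by (auto intro!: real_le_lsqrt)
  from this[OF w a] have A0: "A0 \<le> \<bar>a\<bar>" "0 \<le> A0" "A0\<^sup>2 / 2 = r / (1 + r) * L" "A0 \<le> ?A"
    unfolding A0_def by blast+
  have split: "L - r / (1 + r) * L = L / (1 + r)" using r by (simp add: field_simps)
  fix x y
  let ?B0 = "1 + (L / (1 + r) + ?A * ((1 + (x - a)\<^sup>2) / 2)) + ln (1 + 1 / r) / 2"
  let ?z = "x - a"
  have "A0\<^sup>2 / 2 - A0 * \<bar>?z\<bar> \<le> x\<^sup>2 / 2"
  proof (cases "\<bar>?z\<bar> \<le> A0")
    case True
    then have "(A0 - \<bar>?z\<bar>)\<^sup>2 \<le> \<bar>x\<bar>\<^sup>2"
      using A0(1) by (intro power_mono) auto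
    then have "A0\<^sup>2 - 2 * (A0 * \<bar>?z\<bar>) + \<bar>?z\<bar>\<^sup>2 \<le> x\<^sup>2" by (simp add: power2_diff)
    then show ?thesis using zero_le_power2[of "\<bar>?z\<bar>"] by linarith
  next
    case False
    then have "A0 * A0 \<le> A0 * \<bar>?z\<bar>" using A0 by (intro mult_left_mono) auto
    moreover have "0 \<le> A0 * A0" using A0 by simp
    moreover have "0 \<le> x * x" by simp
    ultimately show ?thesis unfolding power2_eq_square by linarith
  qed
  moreover have "A0 * \<bar>?z\<bar> \<le> ?A * ((1 + ?z\<^sup>2) / 2)"
    using A0 abs_le_half_one_plus_square L by (intro mult_mono) auto
  ultimately have "L - x\<^sup>2 / 2 \<le> L / (1 + r) + ?A * ((1 + ?z\<^sup>2) / 2)"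
    using A0(3) split by linarith
  moreover have "1 / (\<eta> * exp (x\<^sup>2 / 2)) = exp (L - x\<^sup>2 / 2)"
    using exp_add[of "- L" "x\<^sup>2 / 2"] exp_minus[of "x\<^sup>2 / 2 - L"] by (simp add: \<eta>L inverse_eq_divide)
  moreover have "0 \<le> L / (1 + r) + ?A * ((1 + ?z\<^sup>2) / 2)"
    using L r by (intro add_nonneg_nonneg mult_nonneg_nonneg) auto
  ultimately have "ln (1 + 1 / (\<eta> * exp (x\<^sup>2 / 2))) \<le> 1 + (L / (1 + r) + ?A * ((1 + ?z\<^sup>2) / 2))"
    using ln_one_plus_exp_le by simp
  moreover have "(y - x)\<^sup>2 / (2 * (1 + r)) =
      ?z\<^sup>2 / (2 * (1 + r)) + (- ?z / (1 + r)) * (y - a) + 1 / (2 * (1 + r)) * (y - a)\<^sup>2"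
  proof -
    have sq: "(y - x)\<^sup>2 = ?z\<^sup>2 - 2 * ?z * (y - a) + (y - a)\<^sup>2"
      by (simp add: power2_eq_square algebra_simps)
    have "(A - 2 * B * C + E) / (2 * k) = A / (2 * k) + (- B / k) * C + 1 / (2 * k) * E"
      if "0 < k" for A B C E k :: real
      using that by (simp add: field_simps)
    then show ?thesis unfolding sq using r by (metis add_pos_pos zero_less_one)
  qed
  ultimately show "ln (normal_density a (sqrt r) y / mix_density \<eta> r x y) \<le>
      ?B0 + ?z\<^sup>2 / (2 * (1 + r)) + (- ?z / (1 + r)) * (y - a) + (1 / (2 * (1 + r)) - 1 / (2 * r)) * (y - a)\<^sup>2"
    using ln_ratio_le_flat[of a y x] by (simp add: left_diff_distrib)
  show "has_normal_mean a r (\<lambda>y. ?B0 + ?z\<^sup>2 / (2 * (1 + r)) + (- ?z / (1 + r)) * (y - a) + (1 / (2 * (1 + r)) - 1 / (2 * r)) * (y - a)\<^sup>2)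
      (?B0 + ?z\<^sup>2 / (2 * (1 + r)) + (1 / (2 * (1 + r)) - 1 / (2 * r)) * r)"
    by (rule has_normal_mean_quadratic[OF r])
  show "has_normal_mean a 1 (\<lambda>x. 1 + (L / (1 + r) + ?A * ((1 + (x - a)\<^sup>2) / 2)) + ln (1 + 1 / r) / 2
        + (x - a)\<^sup>2 / (2 * (1 + r)) + (1 / (2 * (1 + r)) - 1 / (2 * r)) * r)
      (1 + L / (1 + r) + ?A + ln (1 + 1 / r) / 2 + 1 / (2 * (1 + r)) + (1 / (2 * (1 + r)) - 1 / (2 * r)) * r)"
    by (rule has_normal_mean_cong[OF has_normal_mean_quadratic[OF zero_less_one, of _
          "1 + L / (1 + r) + ?A / 2 + ln (1 + 1 / r) / 2 + (1 / (2 * (1 + r)) - 1 / (2 * r)) * r" 0 "?A / 2 + 1 / (2 * (1 + r))"]])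
       (auto simp: add_divide_distrib distrib_left distrib_right)
  have "c + (c - d) * r = 0" if "c * (1 + r) = 1 / 2" "d * r = 1 / 2" for c d :: real
    using that by (simp add: algebra_simps)
  from this[of "1 / (2 * (1 + r))" "1 / (2 * r)"]
  have "1 / (2 * (1 + r)) + (1 / (2 * (1 + r)) - 1 / (2 * r)) * r = 0" using r by simp
  then show "1 + L / (1 + r) + ?A + ln (1 + 1 / r) / 2 + 1 / (2 * (1 + r)) + (1 / (2 * (1 + r)) - 1 / (2 * r)) * r
      \<le> L / (1 + r) + ?A + 1 + ln (1 + 1 / r) / 2" by linarith
qed

end

lemma minimax_risk_upper:
  fixes r L :: real and n s :: nat
  assumes r: "0 < r" and s: "1 \<le> s" "s \<le> n" and L: "2 \<le> L" "L = ln (real n / real s)"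
  shows "minimax_risk n r (sparse_params n s) \<le>
    ereal (real s * (L / (1 + r) + sqrt (2 * L) + 3 / 2 + ln (1 + 1 / r) / 2 + 6 * sqrt L))"
proof -
  define \<eta> where "\<eta> = exp (- L)"
  have \<eta>: "0 < \<eta>" "real n * \<eta> = real s"
    using s L(2) by (auto simp: \<eta>_def exp_minus)
  define K where "K = L / (1 + r) + sqrt (2 * L) + 3 / 2 + ln (1 + 1 / r) / 2"
  have ln0: "0 \<le> ln (1 + 1 / r)" using r by simp
  have K: "0 \<le> K" using r L ln0 unfolding K_def by (intro add_nonneg_nonneg) auto
  let ?p = "\<lambda>x y. \<Prod>i<n. mix_density \<eta> r (x i) (y i)"
  have "KL_risk n r \<theta> ?p \<le> ereal (real s * (K + 6 * sqrt L))" if \<theta>: "\<theta> \<in> sparse_params n s" for \<theta>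
  proof -
    let ?S = "{i \<in> {..<n}. \<theta> i \<noteq> 0}"
    have "coord_risk_le r (mix_density \<eta> r) (\<theta> i) (if \<theta> i = 0 then 6 * \<eta> * sqrt L else K)" for i
    proof (cases "\<theta> i = 0")
      case True
      then show ?thesis using coord_risk_zero[OF \<eta>(1) r L(1) \<eta>_def] by simp
    next
      case False
      have L0: "0 \<le> L" using L by simp
      have "coord_risk_le r (mix_density \<eta> r) (\<theta> i) K"
      proof (cases "(\<theta> i)\<^sup>2 / 2 \<le> r / (1 + r) * L")
        case True
        show ?thesis
          by (rule coord_risk_weaken[OF coord_risk_small[OF \<eta>(1) r L0 \<eta>_def True]]) (use ln0 in \<open>unfold K_def, linarith\<close>)
      next
        case False
        then have le: "r / (1 + r) * L \<le> (\<theta> i)\<^sup>2 / 2" by linarith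
        show ?thesis
          by (rule coord_risk_weaken[OF coord_risk_large[OF \<eta>(1) r L0 \<eta>_def le]]) (unfold K_def, linarith)
      qed
      then show ?thesis using False by simp
    qed
    then have "KL_risk n r \<theta> ?p \<le> ereal (\<Sum>i<n. if \<theta> i = 0 then 6 * \<eta> * sqrt L else K)"
      by (intro KL_risk_product_le_coord_risk r mix_density_pos \<eta>)
    also have "(\<Sum>i<n. if \<theta> i = 0 then 6 * \<eta> * sqrt L else K) \<le>
        (\<Sum>i<n. 6 * \<eta> * sqrt L + (if \<theta> i \<noteq> 0 then K else 0))"
      using \<eta>(1) L by (intro sum_mono) auto
    also have "\<dots> = 6 * (real n * \<eta>) * sqrt L + real (card ?S) * K"
      by (simp add: sum.distrib sum.If_cases Int_def)
    also have "\<dots> \<le> 6 * real s * sqrt L + real s * K"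
      using \<theta> K L(1) by (intro add_mono mult_right_mono) (auto simp: \<eta>(2) sparse_params_def)
    also have "\<dots> = real s * (K + 6 * sqrt L)" by (simp add: algebra_simps)
    finally show ?thesis by simp
  qed
  then have "minimax_risk n r (sparse_params n s) \<le> ereal (real s * (K + 6 * sqrt L))"
    unfolding minimax_risk_def
    by (intro INF_lower2[OF product_mix_density_estimator[OF \<eta>(1) r]] SUP_least)
  then show ?thesis by (simp add: K_def)
qed

section \<open>The asymptotic minimax risk\<close>

theorem mainTheorem1:
  fixes r :: real and s :: "nat \<Rightarrow> nat" and \<eta> :: "nat \<Rightarrow> real"
  assumes r_pos: "0 < r"
    and s_bounds: "\<And>n. 1 \<le> n \<Longrightarrow> 1 \<le> s n \<and> s n \<le> n"
    and eta: "\<And>n. 1 \<le> n \<Longrightarrow> \<eta> n = real (s n) / real n"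
    and eta_lim: "\<eta> \<longlonglongrightarrow> 0"
  shows "(\<lambda>n. minimax_risk n r (sparse_params n (s n)) /
              ereal (1 / (1 + r) * real (s n) * ln (real n / real (s n)))) \<longlonglongrightarrow> 1
       \<and> (\<forall>n\<ge>1. 1 / (1 + r) * real (s n) * ln (real n / real (s n)) =
                1 / (1 + r) * real n * \<eta> n * ln (inverse (\<eta> n)))"
proof
  show "\<forall>n\<ge>1. 1 / (1 + r) * real (s n) * ln (real n / real (s n)) =
      1 / (1 + r) * real n * \<eta> n * ln (inverse (\<eta> n))"
  proof (intro allI impI)
    fix n :: nat assume n: "1 \<le> n"
    have "real n * \<eta> n = real (s n)" "inverse (\<eta> n) = real n / real (s n)"
      using n eta[OF n] by auto
    then show "1 / (1 + r) * real (s n) * ln (real n / real (s n)) =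
        1 / (1 + r) * real n * \<eta> n * ln (inverse (\<eta> n))"
      by (simp add: mult.assoc)
  qed
next
  define t where "t = (\<lambda>n. real n / real (s n))"
  have t_eq: "t n = inverse (\<eta> n)" if "1 \<le> n" for n
    using eta[OF that] by (simp add: t_def)
  have eta_pos: "\<forall>\<^sub>F n in sequentially. 0 < \<eta> n"
  proof (rule eventually_sequentiallyI)
    fix n :: nat assume n: "1 \<le> n"
    then show "0 < \<eta> n" using eta[OF n] s_bounds[OF n] by auto
  qed
  have t_lim: "filterlim t at_top sequentially"
    by (rule filterlim_mono_eventually[OF filterlim_inverse_at_top[OF eta_lim eta_pos] order_refl order_refl])
       (auto simp: eventually_sequentially t_eq intro!: exI[of _ 1])
  define K where "K = 3 / 2 + ln (1 + 1 / r) / 2"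
  \<comment> \<open>The two bounds divided by the claimed rate, as functions of \<open>u = n / s\<close>.\<close>
  define lo where "lo = (\<lambda>u. ln (u - 1) / ln u - (1 + r) * (2 / ln u)
      - (1 + r) * (2 * (1 + 1 / r)) * (sqrt (2 * ln u) / ln u))"
  define up where "up = (\<lambda>u. 1 + (1 + r) * (sqrt (2 * ln u) / ln u)
      + (1 + r) * K * (1 / ln u) + (1 + r) * 6 * (sqrt (ln u) / ln u))"
  have l: "((\<lambda>u::real. ln (u - 1) / ln u) \<longlongrightarrow> 1) at_top" "((\<lambda>u::real. 2 / ln u) \<longlongrightarrow> 0) at_top"
    "((\<lambda>u::real. 1 / ln u) \<longlongrightarrow> 0) at_top" "((\<lambda>u::real. sqrt (2 * ln u) / ln u) \<longlongrightarrow> 0) at_top"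
    "((\<lambda>u::real. sqrt (ln u) / ln u) \<longlongrightarrow> 0) at_top"
    by real_asymp+
  have lo: "(lo \<longlongrightarrow> 1) at_top"
    unfolding lo_def
    by (rule tendsto_eq_rhs, (rule l | rule tendsto_diff | rule tendsto_mult_left)+) simp
  have up: "(up \<longlongrightarrow> 1) at_top"
    unfolding up_def
    by (rule tendsto_eq_rhs, (rule l | rule tendsto_const | rule tendsto_add | rule tendsto_mult_left)+) simp
  have large: "\<forall>\<^sub>F n in sequentially. 1 \<le> n \<and> exp 2 \<le> t n"
    using t_lim eventually_ge_at_top[of "1::nat"] by (auto simp: filterlim_at_top eventually_conj_iff)
  let ?R = "\<lambda>n. minimax_risk n r (sparse_params n (s n)) /
    ereal (1 / (1 + r) * real (s n) * ln (real n / real (s n)))"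
  have bounds: "ereal (lo (t n)) \<le> ?R n \<and> ?R n \<le> ereal (up (t n))" if "1 \<le> n \<and> exp 2 \<le> t n" for n
  proof -
    have n: "1 \<le> n" and tn: "exp 2 \<le> t n" using that by auto
    have s: "1 \<le> s n" "s n \<le> n" using s_bounds[OF n] by auto
    define L where "L = ln (t n)"
    have tpos: "0 < t n" using tn exp_gt_zero[of "2::real"] by linarith
    have "t n > 2" using tn exp_ge_add_one_self[of 2] by linarith
    have L: "2 \<le> L" unfolding L_def using tn tpos by (simp add: ln_ge_iff)
    define D where "D = 1 / (1 + r) * real (s n) * L"
    have D: "0 < D" "ereal (1 / (1 + r) * real (s n) * ln (real n / real (s n))) = ereal D"
    proof -
      show "0 < D" unfolding D_def using r_pos s L by (intro mult_pos_pos) auto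
    qed (simp add: D_def L_def t_def)
    define m where "m = n div s n"
    have m: "1 \<le> m" "s n * m \<le> n"
      using s by (auto simp: m_def div_greater_zero_iff Suc_le_eq)
    have "n < (m + 1) * s n"
      using dividend_less_div_times[of "s n" n] s by (simp add: m_def)
    then have "real n < (real m + 1) * real (s n)"
      by (metis of_nat_1 of_nat_add of_nat_less_iff of_nat_mult)
    then have mt: "t n - 1 \<le> real m" "real m \<le> t n"
      using s of_nat_div_le_of_nat[of n "s n", where 'a = real]
      by (auto simp: m_def t_def diff_le_eq divide_le_eq)
    have lnm: "0 \<le> ln (real m)" "ln (t n - 1) \<le> ln (real m)" "ln (real m) \<le> L"
      unfolding L_def using m mt \<open>t n > 2\<close> by auto
    define \<mu> where "\<mu> = sqrt (2 * (r / (1 + r)) * ln (real m))"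
    have \<mu>2: "\<mu>\<^sup>2 = 2 * (r / (1 + r)) * ln (real m)" and \<mu>0: "0 \<le> \<mu>"
      using lnm r_pos by (auto simp: \<mu>_def)
    have "r / (1 + r) * ln (real m) \<le> 1 * L"
      using r_pos lnm by (intro mult_mono) auto
    then have \<mu>L: "\<mu> \<le> sqrt (2 * L)" unfolding \<mu>_def by (intro real_sqrt_le_mono) linarith
    have "\<mu>\<^sup>2 / 2 * (1 + 1 / r) = ln (real m)"
    proof -
      have "r / (1 + r) * (1 + 1 / r) = 1" using r_pos by (simp add: distrib_left add_divide_distrib[symmetric])
      moreover have "2 * a * b / 2 * c = a * c * b" for a b c :: real by simp
      ultimately show ?thesis unfolding \<mu>2 by (metis mult_1)
    qed
    from minimax_risk_lower[OF r_pos \<mu>0 this m]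
    have "ereal (real (s n) * (\<mu>\<^sup>2 / (2 * r) - (2 + 2 * \<mu> * (1 + 1 / r)))) \<le> minimax_risk n r (sparse_params n (s n))" .
    from ereal_divide_right_mono[OF this, of "ereal D"]
    have "ereal (real (s n) * (\<mu>\<^sup>2 / (2 * r) - (2 + 2 * \<mu> * (1 + 1 / r))) / D) \<le> ?R n"
      using D by simp
    moreover have "lo (t n) \<le> real (s n) * (\<mu>\<^sup>2 / (2 * r) - (2 + 2 * \<mu> * (1 + 1 / r))) / D"
    proof -
      have "real (s n) * (\<mu>\<^sup>2 / (2 * r) - (2 + 2 * \<mu> * (1 + 1 / r))) / D =
          (1 + r) * (\<mu>\<^sup>2 / (2 * r) - (2 + 2 * \<mu> * (1 + 1 / r))) / L"
        using s r_pos by (simp add: D_def)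
      also have "(1 + r) * (\<mu>\<^sup>2 / (2 * r) - (2 + 2 * \<mu> * (1 + 1 / r))) =
          ln (real m) - (1 + r) * 2 - (1 + r) * (2 * (1 + 1 / r)) * \<mu>"
      proof -
        have "(1 + r) * (\<mu>\<^sup>2 / (2 * r)) = ln (real m)"
          unfolding \<mu>2 using r_pos by simp
        moreover have "k * (a - (2 + 2 * b * c)) = k * a - k * 2 - k * (2 * c) * b" for a b c k :: real
          by (simp add: algebra_simps)
        ultimately show ?thesis by metis
      qed
      finally have eq: "real (s n) * (\<mu>\<^sup>2 / (2 * r) - (2 + 2 * \<mu> * (1 + 1 / r))) / D =
          (ln (real m) - (1 + r) * 2 - (1 + r) * (2 * (1 + 1 / r)) * \<mu>) / L" .
      have "lo (t n) = (ln (t n - 1) - (1 + r) * 2 - (1 + r) * (2 * (1 + 1 / r)) * sqrt (2 * L)) / L"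
        by (simp add: lo_def L_def diff_divide_distrib)
      also have "\<dots> \<le> (ln (real m) - (1 + r) * 2 - (1 + r) * (2 * (1 + 1 / r)) * \<mu>) / L"
        using L r_pos lnm \<mu>L by (intro divide_right_mono diff_mono mult_left_mono) auto
      finally show ?thesis unfolding eq .
    qed
    ultimately have lower: "ereal (lo (t n)) \<le> ?R n"
      by (meson ereal_less_eq(3) order_trans)
    have "minimax_risk n r (sparse_params n (s n)) \<le>
        ereal (real (s n) * (L / (1 + r) + sqrt (2 * L) + 3 / 2 + ln (1 + 1 / r) / 2 + 6 * sqrt L))"
      by (rule minimax_risk_upper[OF r_pos s L]) (simp add: L_def t_def)
    from ereal_divide_right_mono[OF this, of "ereal D"]
    have "?R n \<le> ereal (real (s n) * (L / (1 + r) + sqrt (2 * L) + 3 / 2 + ln (1 + 1 / r) / 2 + 6 * sqrt L) / D)"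
      using D by simp
    also have "real (s n) * (L / (1 + r) + sqrt (2 * L) + 3 / 2 + ln (1 + 1 / r) / 2 + 6 * sqrt L) / D = up (t n)"
    proof -
      have "real (s n) * (L / (1 + r) + sqrt (2 * L) + 3 / 2 + ln (1 + 1 / r) / 2 + 6 * sqrt L) / D =
          (1 + r) * (L / (1 + r) + sqrt (2 * L) + K + 6 * sqrt L) / L"
        using s r_pos by (simp add: D_def K_def add.assoc)
      also have "(1 + r) * (L / (1 + r) + sqrt (2 * L) + K + 6 * sqrt L) =
          L + (1 + r) * sqrt (2 * L) + (1 + r) * K + (1 + r) * 6 * sqrt L"
        using r_pos by (simp add: distrib_left)
      also have "\<dots> / L = up (t n)"
        using L by (simp add: up_def L_def[symmetric] add_divide_distrib)
      finally show ?thesis .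
    qed
    finally show ?thesis using lower by simp
  qed
  show "?R \<longlonglongrightarrow> 1"
  proof (rule tendsto_sandwich)
    show "\<forall>\<^sub>F n in sequentially. ereal (lo (t n)) \<le> ?R n" "\<forall>\<^sub>F n in sequentially. ?R n \<le> ereal (up (t n))"
      using large bounds by (auto elim!: eventually_mono)
    show "(\<lambda>n. ereal (lo (t n))) \<longlonglongrightarrow> 1" "(\<lambda>n. ereal (up (t n))) \<longlonglongrightarrow> 1"
      using filterlim_compose[OF lo t_lim] filterlim_compose[OF up t_lim]
      by (simp_all add: one_ereal_def)
  qed
qed

end
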